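(* Consider the family of load balancing systems parametrized by $\epsilon\in(0,\mu_\Sigma)$ described in the context, operating under the power-of-two choices routing policy, where all the servers are identical, and assume $\lim_{\epsilon\downarrow0}\sigma_a^{(\epsilon)}=\sigma_a$. Let $\overline{\boldsymbol q}^{(\epsilon)}$ be the steady-state random vector to which $\{\boldsymbol q^{(\epsilon)}(k):k\ge1\}$ converges in distribution. Then, as $\epsilon\downarrow0$, $\epsilon\overline{\boldsymbol q}^{(\epsilon)}$ converges in distribution to $\widetilde\Upsilon_2\boldsymbol 1$, where $\widetilde\Upsilon_2$ is an exponential random variable with mean $$\frac{1}{2n}\Big(\sigma_a^2+\sum_{i=1}^n\sum_{j=1}^n\mathrm{Cov}[s_i,s_j]\Big).$$
   Context: Load balancing system: a discrete-time system with $n$ queues, each with its own server and infinite buffer. $q_i^{(\epsilon)}(k)$ is the number of jobs in queue $i$ at the beginning of slot $k\ge 1$. The potential service vectors $\boldsymbol s(k)=(s_1(k),\dots,s_n(k))$, $k\ge1$, are i.i.d. over $k$ with nonnegative integer components that may be correlated with each other; they do not depend on $\epsilon$, and are independent of the queue lengths $\boldsymbol q^{(\epsilon)}(k)$. Identical servers means that $s_1(1),\dots,s_n(1)$ have the same distribution. $\mu_i=E[s_i(1)]$, $\mu_\Sigma=\sum_{i=1}^n\mu_i$, and $\mathrm{Cov}[s_i,s_j]$ is the covariance of $s_i(1)$ and $s_j(1)$. There is a single arrival stream: $\{a^{(\epsilon)}(k):k\ge1\}$ is an i.i.d. sequence of nonnegative integer-valued random variables, independent of the queue lengths and of the service process,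 with $E[a^{(\epsilon)}(1)]=\mu_\Sigma-\epsilon$ and $\mathrm{Var}[a^{(\epsilon)}(1)]=(\sigma_a^{(\epsilon)})^2$. There are finite constants $A_{\max},S_{\max}$ (not depending on $\epsilon$) with $a^{(\epsilon)}(k)\le A_{\max}$ and $s_i(k)\le S_{\max}$ with probability 1. In slot $k$ all arrivals are routed to one queue $i^*(k)$: $a_i^{(\epsilon)}(k)=a^{(\epsilon)}(k)$ if $i=i^*(k)$ and $0$ otherwise. Under power-of-two choices, in each slot two queues $i_1,i_2\in\{1,\dots,n\}$ are selected uniformly at random and $i^*(k)\in\arg\min_{i\in\{i_1,i_2\}}q_i^{(\epsilon)}(k)$, breaking ties at random. The dynamics are $q_i^{(\epsilon)}(k+1)=\max\{q_i^{(\epsilon)}(k)+a_i^{(\epsilon)}(k)-s_i(k),0\}$. $\boldsymbol 1$ is the all-ones vector. *)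

theory Defs
  imports "HOL-Probability.Probability"
begin

text \<open>
  Convergence in distribution along a filter, by bounded continuous test functions; the library
  has it only for sequences of laws on \<open>real\<close>.  The variables may live on different probability
  spaces.  They are meant to be measurable: the Bochner integral of a nonmeasurable function is 0.
  On \<open>nat ^ 'n\<close>, whose topology is discrete, every function is a continuous test function.
\<close>

definition converges_in_distribution ::
  "('i \<Rightarrow> 'a measure) \<Rightarrow> ('i \<Rightarrow> 'a \<Rightarrow> 'v::topological_space) \<Rightarrow> 'b measure \<Rightarrow> ('b \<Rightarrow> 'v) \<Rightarrow>
   'i filter \<Rightarrow> bool" where
  "converges_in_distribution M X N Y F \<longleftrightarrow>
     (\<forall>f :: 'v \<Rightarrow> real. continuous_on UNIV f \<longrightarrow> bounded (range f) \<longrightarrow>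
        ((\<lambda>i. \<integral>\<omega>. f (X i \<omega>) \<partial>M i) \<longlongrightarrow> (\<integral>\<omega>. f (Y \<omega>) \<partial>N)) F)"

definition covariance :: "'a measure \<Rightarrow> ('a \<Rightarrow> real) \<Rightarrow> ('a \<Rightarrow> real) \<Rightarrow> real" where
  "covariance M X Y =
     (\<integral>\<omega>. (X \<omega> - (\<integral>\<omega>'. X \<omega>' \<partial>M)) * (Y \<omega> - (\<integral>\<omega>'. Y \<omega>' \<partial>M)) \<partial>M)"

text \<open>
  The parameter of \<open>exponential_density\<close> is the rate.  Mean 0 is read as the degenerate
  law at 0, so that a vanishing limiting variance is not excluded.
\<close>

definition exponential_with_mean :: "'a measure \<Rightarrow> ('a \<Rightarrow> real) \<Rightarrow> real \<Rightarrow> bool" where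
  "exponential_with_mean M X m \<longleftrightarrow>
     X \<in> borel_measurable M \<and>
     (if m = 0 then AE \<omega> in M. X \<omega> = 0 else distributed M lborel X (exponential_density (1 / m)))"

definition real_vec :: "nat ^ 'n \<Rightarrow> real ^ 'n" where
  "real_vec x = (\<chi> i. real (x $ i))"

definition service_rate :: "'a measure \<Rightarrow> (nat \<Rightarrow> 'a \<Rightarrow> nat ^ 'n) \<Rightarrow> 'n \<Rightarrow> real" where
  "service_rate M s i = (\<integral>\<omega>. real (s 1 \<omega> $ i) \<partial>M)"

definition total_service_rate :: "'a measure \<Rightarrow> (nat \<Rightarrow> 'a \<Rightarrow> nat ^ 'n) \<Rightarrow> real" where
  "total_service_rate M s = (\<Sum>i\<in>UNIV. service_rate M s i)"

text \<open>
  The two queues may be drawn with or without replacement; drawing uniformly from these ordered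
  pairs covers both conventions.
\<close>

definition candidate_pairs :: "bool \<Rightarrow> ('n \<times> 'n) set" where
  "candidate_pairs with_replacement =
     (if with_replacement then UNIV else {(i, j). i \<noteq> j})"

text \<open>The Boolean argument is the coin that decides a tie.\<close>

definition shorter_queue :: "nat ^ 'n \<Rightarrow> 'n \<times> 'n \<Rightarrow> bool \<Rightarrow> 'n" where
  "shorter_queue x p c =
     (case p of (i, j) \<Rightarrow>
        if x $ i < x $ j then i
        else if x $ j < x $ i then j
        else if c then i else j)"

text \<open>
  The independent sources of randomness take values in different types, so their joint
  independence is stated through the generated families of events.
\<close>

datatype noise = Initial | Service nat | Arrival nat | Candidates nat | Coin nat

fun noise_events ::
  "'a measure \<Rightarrow> ('a \<Rightarrow> nat ^ 'n) \<Rightarrow> (nat \<Rightarrow> 'a \<Rightarrow> nat ^ 'n) \<Rightarrow> (nat \<Rightarrow> 'a \<Rightarrow> nat) \<Rightarrow>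
   (nat \<Rightarrow> 'a \<Rightarrow> 'n \<times> 'n) \<Rightarrow> (nat \<Rightarrow> 'a \<Rightarrow> bool) \<Rightarrow> noise \<Rightarrow> 'a set set" where
  "noise_events M q1 s a cand coin Initial = {q1 -` A \<inter> space M | A. True}"
| "noise_events M q1 s a cand coin (Service k) = {s k -` A \<inter> space M | A. True}"
| "noise_events M q1 s a cand coin (Arrival k) = {a k -` A \<inter> space M | A. True}"
| "noise_events M q1 s a cand coin (Candidates k) = {cand k -` A \<inter> space M | A. True}"
| "noise_events M q1 s a cand coin (Coin k) = {coin k -` A \<inter> space M | A. True}"

text \<open>
  One system, for a fixed \<open>eps\<close>.  Slots are numbered from 1; values at slot 0 are irrelevant.
  The queue lengths \<open>q k\<close> are functions of the noise with index \<open>Initial\<close> and of the noise of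
  slots before \<open>k\<close>, so \<open>independent\<close> makes \<open>s k\<close>, \<open>a k\<close>, \<open>cand k\<close> and \<open>coin k\<close> independent
  of \<open>q k\<close>.
\<close>

locale power_of_two_system = prob_space M
  for M :: "'a measure"
    and with_replacement :: bool
    and A_max S_max :: real
    and s :: "nat \<Rightarrow> 'a \<Rightarrow> nat ^ 'n"
    and eps sd_a :: real
    and a :: "nat \<Rightarrow> 'a \<Rightarrow> nat"
    and cand :: "nat \<Rightarrow> 'a \<Rightarrow> 'n \<times> 'n"
    and coin :: "nat \<Rightarrow> 'a \<Rightarrow> bool"
    and q :: "nat \<Rightarrow> 'a \<Rightarrow> nat ^ 'n" +
  assumes q1_rv: "random_variable (count_space UNIV) (q 1)"
    and s_rv: "k \<ge> 1 \<Longrightarrow> random_variable (count_space UNIV) (s k)"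
    and a_rv: "k \<ge> 1 \<Longrightarrow> random_variable (count_space UNIV) (a k)"
    and cand_rv: "k \<ge> 1 \<Longrightarrow> random_variable (count_space UNIV) (cand k)"
    and coin_rv: "k \<ge> 1 \<Longrightarrow> random_variable (count_space UNIV) (coin k)"
    and independent:
      "indep_sets (noise_events M (q 1) s a cand coin)
         ({Initial} \<union> (\<Union>k\<in>{1..}. {Service k, Arrival k, Candidates k, Coin k}))"
    and s_distr: "k \<ge> 1 \<Longrightarrow> distr M (count_space UNIV) (s k) = distr M (count_space UNIV) (s 1)"
    and a_distr: "k \<ge> 1 \<Longrightarrow> distr M (count_space UNIV) (a k) = distr M (count_space UNIV) (a 1)"
    and s_bounded: "k \<ge> 1 \<Longrightarrow> AE \<omega> in M. real (s k \<omega> $ i) \<le> S_max"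
    and a_bounded: "k \<ge> 1 \<Longrightarrow> AE \<omega> in M. real (a k \<omega>) \<le> A_max"
    and a_mean: "expectation (\<lambda>\<omega>. real (a 1 \<omega>)) = total_service_rate M s - eps"
    and a_variance: "variance (\<lambda>\<omega>. real (a 1 \<omega>)) = sd_a\<^sup>2"
    and candidates_exist: "candidate_pairs with_replacement \<noteq> ({} :: ('n \<times> 'n) set)"
    and cand_distr:
      "k \<ge> 1 \<Longrightarrow> distr M (count_space UNIV) (cand k) =
         measure_pmf (pmf_of_set (candidate_pairs with_replacement))"
    and coin_distr:
      "k \<ge> 1 \<Longrightarrow> distr M (count_space UNIV) (coin k) = measure_pmf (bernoulli_pmf (1 / 2))"
    and dynamics:
      "k \<ge> 1 \<Longrightarrow> \<omega> \<in> space M \<Longrightarrow>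
         int (q (Suc k) \<omega> $ i) =
           max (int (q k \<omega> $ i)
                + (if i = shorter_queue (q k \<omega>) (cand k \<omega>) (coin k \<omega>) then int (a k \<omega>) else 0)
                - int (s k \<omega> $ i)) 0"

definition identical_servers :: "'a measure \<Rightarrow> (nat \<Rightarrow> 'a \<Rightarrow> nat ^ 'n) \<Rightarrow> bool" where
  "identical_servers M s \<longleftrightarrow>
     (\<forall>i j. distr M (count_space UNIV) (\<lambda>\<omega>. s 1 \<omega> $ i) =
            distr M (count_space UNIV) (\<lambda>\<omega>. s 1 \<omega> $ j))"

end

theory Submission
  imports Defs
begin

text \<open>
  Write \<open>N\<close> for the total queue length.  In one slot it changes by the net flow \<open>d\<close>
  (arrivals minus potential services), which is independent of the present queues, plus the unused
  service \<open>u \<ge> 0\<close>, so \<open>N' = N + d + u\<close> with \<open>E d = - \<epsilon>\<close>.  In steady state \<open>N\<close> and \<open>N'\<close> have the same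
  law; this gives \<open>E u = \<epsilon>\<close> and, for the characteristic function \<open>\<phi>\<close> of \<open>N\<close>,
  \<open>\<phi>(\<tau>) (E e^(i\<tau>d) - 1) = E [e^(i\<tau>N') (e^(- i\<tau>u) - 1)]\<close>.
  Put \<open>\<tau> = \<epsilon> t\<close> and divide by \<open>\<epsilon>\<^sup>2\<close>.  Taylor expansion of the bounded variable \<open>d\<close> turns the
  factor on the left into \<open>- it - t\<^sup>2 v / 2 + o(1)\<close>, where \<open>v\<close> is the limiting variance of \<open>d\<close>.  If
  the right-hand side tends to \<open>- it\<close>, then \<open>\<phi>(\<epsilon> t) \<longlongrightarrow> 1 / (1 - i t v / 2)\<close>, the transform of an
  exponential variable of mean \<open>v / 2\<close>.

  The right-hand side tends to \<open>- it\<close> as soon as \<open>E [N' u] \<longlongrightarrow> 0\<close>, which says that service is wasted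
  mostly when the whole system is nearly empty.  Service is wasted only at a queue that is empty
  afterwards, so \<open>N' u\<close> is at most \<open>D' u\<close>, with \<open>D\<close> the sum of the distances between the queues and
  \<open>D'\<close> its value after the slot (\<open>total_times_unused_le\<close>).  Since \<open>u\<close> is bounded and \<open>E u = \<epsilon>\<close>, the
  inequality of arithmetic and geometric means shows that a bound on \<open>E D\<^sup>2\<close> that is
  uniform in \<open>\<epsilon>\<close> is then enough (\<open>transform_boundary_term\<close>).  That bound
  (\<open>state_space_collapse\<close>) is where the routing rule enters: the shorter of two random queues lies
  below the average by an amount proportional to \<open>D\<close> (\<open>expected_shorter_queue_le\<close>), whereas identical
  servers pull all queues down equally on average, so the square of the sum of squared
  distances has drift of order \<open>- D\<^sup>3\<close> (\<open>spread_drift\<close>).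

  Every queue is within \<open>D\<close> of \<open>N / n\<close>, and by the same bound \<open>\<epsilon> D\<close> vanishes in the limit.
  Hence \<open>\<epsilon>\<close> times the queue length vector has the same limit as \<open>\<epsilon> N / n\<close> times the all-ones vector,
  and Levy's continuity theorem applies to the scalar \<open>\<epsilon> N / n\<close>.
\<close>

section \<open>Expectations under countable laws\<close>

text \<open>
  For countable types the product sigma-algebra is discrete, which makes Fubini's theorem available
  for expectations under \<open>pair_pmf\<close>.
\<close>

lemma measure_pair_pmf:
  fixes A :: "'a::countable pmf" and B :: "'b::countable pmf"
  shows "measure_pmf (pair_pmf A B) = measure_pmf A \<Otimes>\<^sub>M measure_pmf B"
proof (rule measure_eqI_countable[where A = UNIV])
  show "sets (measure_pmf A \<Otimes>\<^sub>M measure_pmf B) = Pow UNIV"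
  proof -
    have "sets (measure_pmf A \<Otimes>\<^sub>M measure_pmf B) =
        sets (count_space (UNIV :: 'a set) \<Otimes>\<^sub>M count_space (UNIV :: 'b set))"
      by (intro sets_pair_measure_cong) auto
    also have "\<dots> = sets (count_space UNIV)"
      by (subst pair_measure_countable) auto
    finally show ?thesis by simp
  qed
next
  fix z :: "'a \<times> 'b"
  obtain x y where z: "z = (x, y)" by fastforce
  have "emeasure (measure_pmf A \<Otimes>\<^sub>M measure_pmf B) ({x} \<times> {y}) = emeasure A {x} * emeasure B {y}"
    by (intro sigma_finite_measure.emeasure_pair_measure_Times)
       (auto intro: prob_space_imp_sigma_finite prob_space_measure_pmf)
  then show "emeasure (pair_pmf A B) {z} = emeasure (measure_pmf A \<Otimes>\<^sub>M measure_pmf B) {z}"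
    by (simp add: z emeasure_pmf_single pmf_pair ennreal_mult)
qed auto

lemma expectation_pair_pmf:
  fixes A :: "'a::countable pmf" and B :: "'b::countable pmf"
    and f :: "'a \<times> 'b \<Rightarrow> 'c::{banach, second_countable_topology}"
  assumes "integrable (pair_pmf A B) f"
  shows "measure_pmf.expectation (pair_pmf A B) f =
    measure_pmf.expectation A (\<lambda>x. measure_pmf.expectation B (\<lambda>y. f (x, y)))"
proof -
  interpret pair_sigma_finite "measure_pmf A" "measure_pmf B"
    by (intro pair_sigma_finite.intro prob_space_imp_sigma_finite prob_space_measure_pmf)
  show ?thesis
    using integral_fst'[of f] assms by (simp add: measure_pair_pmf)
qed

lemma integrable_pmf_bounded:
  fixes f :: "'a \<Rightarrow> 'c::{banach, second_countable_topology}"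
  assumes "\<And>x. x \<in> set_pmf p \<Longrightarrow> norm (f x) \<le> B"
  shows "integrable (measure_pmf p) f"
  by (rule measure_pmf.integrable_const_bound[where B = B]) (auto simp: AE_measure_pmf_iff assms)

lemma norm_expectation_pmf_le:
  fixes f :: "'a \<Rightarrow> 'c::{banach, second_countable_topology}"
  assumes "integrable (measure_pmf p) f" "integrable (measure_pmf p) g"
    and "\<And>x. x \<in> set_pmf p \<Longrightarrow> norm (f x) \<le> g x"
  shows "norm (measure_pmf.expectation p f) \<le> measure_pmf.expectation p g"
proof -
  have "norm (measure_pmf.expectation p f) \<le> measure_pmf.expectation p (\<lambda>x. norm (f x))"
    by (rule integral_norm_bound)
  also have "\<dots> \<le> measure_pmf.expectation p g"
    using assms by (intro integral_mono_AE) (auto simp: AE_measure_pmf_iff)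
  finally show ?thesis .
qed

lemma expectation_pair_pmf_times:
  fixes A :: "'a::countable pmf" and B :: "'b::countable pmf"
    and f :: "'a \<Rightarrow> 'c::{real_normed_field, banach, second_countable_topology}" and g :: "'b \<Rightarrow> 'c"
  assumes "integrable (pair_pmf A B) (\<lambda>z. f (fst z) * g (snd z))"
  shows "measure_pmf.expectation (pair_pmf A B) (\<lambda>z. f (fst z) * g (snd z)) =
    measure_pmf.expectation A f * measure_pmf.expectation B g"
  by (subst expectation_pair_pmf[OF assms]) simp

lemma integrable_pmf_truncated:
  fixes f :: "'a \<Rightarrow> real"
  assumes "\<And>x. f x \<ge> 0"
  shows "integrable (measure_pmf p) (\<lambda>x. min (f x) (real m))"
proof (rule integrable_pmf_bounded[where B = "real m"])
  show "norm (min (f x) (real m)) \<le> real m" for x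
    using assms[of x] by (simp add: min_def)
qed

text \<open>
  Two nonnegative variables with a common law may have infinite expectation, but a bounded
  difference of them still has mean zero: the truncations at \<open>m\<close> have equal finite expectations,
  and their difference is dominated by the bound, because truncation is 1-Lipschitz.
\<close>

lemma expectation_difference_equal_laws:
  fixes f g :: "'a \<Rightarrow> real"
  assumes law: "map_pmf f p = map_pmf g p"
    and bounded: "\<And>x. x \<in> set_pmf p \<Longrightarrow> \<bar>f x - g x\<bar> \<le> B"
    and nonneg: "\<And>x. f x \<ge> 0" "\<And>x. g x \<ge> 0"
  shows "measure_pmf.expectation p (\<lambda>x. f x - g x) = 0"
proof -
  let ?d = "\<lambda>m x. min (f x) (real m) - min (g x) (real m)"
  have zero: "measure_pmf.expectation p (?d m) = 0" for m
  proof -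
    have "measure_pmf.expectation p (\<lambda>x. min (f x) (real m)) =
        measure_pmf.expectation (map_pmf f p) (\<lambda>y. min y (real m))" by simp
    also have "\<dots> = measure_pmf.expectation p (\<lambda>x. min (g x) (real m))"
      by (simp add: law)
    finally show ?thesis
      using nonneg by (subst Bochner_Integration.integral_diff) (auto intro!: integrable_pmf_truncated)
  qed
  have "(\<lambda>m. measure_pmf.expectation p (?d m)) \<longlonglongrightarrow> measure_pmf.expectation p (\<lambda>x. f x - g x)"
  proof (rule integral_dominated_convergence[where w = "\<lambda>_. B"])
    show "AE x in p. (\<lambda>m. ?d m x) \<longlonglongrightarrow> f x - g x"
    proof (intro AE_I2 tendsto_eventually)
      fix x
      show "\<forall>\<^sub>F m in sequentially. ?d m x = f x - g x"
        using eventually_ge_at_top[of "nat \<lceil>max (f x) (g x)\<rceil>"]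
        by eventually_elim (auto simp: nat_le_iff ceiling_le_iff)
    qed
    show "AE x in p. norm (?d m x) \<le> B" for m
      using bounded by (fastforce simp: AE_measure_pmf_iff min_def abs_if split: if_splits)
  qed auto
  then show ?thesis by (simp add: zero LIMSEQ_const_iff)
qed

text \<open>
  The Foster--Lyapunov moment bound for a stationary law \<open>p\<close>.  Integrating the drift inequality
  is legitimate only if \<open>V\<close> is integrable, which is not known in advance.  The truncation of \<open>V\<close> at
  \<open>m\<close> is bounded and satisfies the same inequality with \<open>f\<close> cut off outside \<open>V \<le> m\<close>: above the
  level \<open>m\<close> the truncated function cannot increase.  Monotone convergence removes the cut-off.
\<close>

lemma stationary_drift_bound:
  fixes p :: "'a::countable pmf" and noise :: "'w::countable pmf"
    and step :: "'a \<Rightarrow> 'w \<Rightarrow> 'a" and V f :: "'a \<Rightarrow> real"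
  assumes stationary: "map_pmf (\<lambda>z. step (fst z) (snd z)) (pair_pmf p noise) = p"
    and finite: "finite (set_pmf noise)"
    and V: "\<And>x. V x \<ge> 0" and f: "\<And>x. f x \<ge> 0" and c: "c \<ge> 0"
    and drift: "\<And>x. measure_pmf.expectation noise (\<lambda>w. V (step x w)) \<le> V x - f x + c"
  shows "integrable p f" and "measure_pmf.expectation p f \<le> c"
proof -
  have fin[simp]: "integrable noise g" for g :: "'w \<Rightarrow> real"
    using finite by (rule integrable_measure_pmf_finite)
  let ?V = "\<lambda>m x. min (V x) (real m)"
  let ?f = "\<lambda>m x. f x * indicator {x. V x \<le> real m} x"
  have f_le: "f x \<le> V x + c" for x
  proof -
    have "0 \<le> measure_pmf.expectation noise (\<lambda>w. V (step x w))" by (simp add: V)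
    with drift[of x] show ?thesis by linarith
  qed
  have f_int: "integrable p (?f m)" for m
  proof (rule integrable_pmf_bounded[where B = "real m + c"])
    show "norm (?f m x) \<le> real m + c" for x
      using f_le[of x] f[of x] c by (auto simp: indicator_def)
  qed
  have truncated: "measure_pmf.expectation p (?f m) \<le> c" for m
  proof -
    have pointwise: "measure_pmf.expectation noise (\<lambda>w. ?V m (step x w)) \<le> ?V m x - ?f m x + c" for x
    proof (cases "V x \<le> real m")
      case True
      have "measure_pmf.expectation noise (\<lambda>w. ?V m (step x w)) \<le>
          measure_pmf.expectation noise (\<lambda>w. V (step x w))"
        by (intro integral_mono) auto
      with drift[of x] True show ?thesis by simp
    next
      case False
      have "measure_pmf.expectation noise (\<lambda>w. ?V m (step x w)) \<le>
          measure_pmf.expectation noise (\<lambda>w. real m)"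
        by (intro integral_mono) auto
      with False c show ?thesis by simp
    qed
    have "measure_pmf.expectation p (?V m) =
        measure_pmf.expectation (pair_pmf p noise) (\<lambda>z. ?V m (step (fst z) (snd z)))"
      by (subst stationary[symmetric]) simp
    also have "\<dots> = measure_pmf.expectation p
        (\<lambda>x. measure_pmf.expectation noise (\<lambda>w. ?V m (step x w)))"
      by (subst expectation_pair_pmf) (auto intro!: integrable_pmf_truncated V)
    also have "\<dots> \<le> measure_pmf.expectation p (\<lambda>x. ?V m x - ?f m x + c)"
    proof (rule integral_mono)
      show "integrable p (\<lambda>x. measure_pmf.expectation noise (\<lambda>w. ?V m (step x w)))"
      proof (rule integrable_pmf_bounded[where B = "real m"])
        fix x
        have "measure_pmf.expectation noise (\<lambda>w. ?V m (step x w)) \<le>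
            measure_pmf.expectation noise (\<lambda>w. real m)"
          by (intro integral_mono) auto
        moreover have "0 \<le> measure_pmf.expectation noise (\<lambda>w. ?V m (step x w))"
          by (simp add: V)
        ultimately show "norm (measure_pmf.expectation noise (\<lambda>w. ?V m (step x w))) \<le> real m"
          by simp
      qed
    qed (use pointwise in \<open>auto intro!: integrable_pmf_truncated V f_int\<close>)
    also have "\<dots> = measure_pmf.expectation p (?V m) - measure_pmf.expectation p (?f m) + c"
      by (simp add: integrable_pmf_truncated V f_int)
    finally show ?thesis by simp
  qed
  have "(\<integral>\<^sup>+x. ennreal (f x) \<partial>p) = (\<integral>\<^sup>+x. (SUP m. ennreal (?f m x)) \<partial>p)"
  proof (rule nn_integral_cong)
    fix x
    have "(SUP m. ennreal (?f m x)) = ennreal (f x)"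
    proof (rule antisym)
      show "(SUP m. ennreal (?f m x)) \<le> ennreal (f x)"
        using f by (intro SUP_least ennreal_leI) (auto simp: indicator_def)
      have "ennreal (f x) \<le> ennreal (?f (nat \<lceil>V x\<rceil>) x)"
        using real_nat_ceiling_ge[of "V x"] by simp
      also have "\<dots> \<le> (SUP m. ennreal (?f m x))" by (rule SUP_upper) simp
      finally show "ennreal (f x) \<le> (SUP m. ennreal (?f m x))" .
    qed
    then show "ennreal (f x) = (SUP m. ennreal (?f m x))" by simp
  qed
  also have "\<dots> = (SUP m. \<integral>\<^sup>+x. ennreal (?f m x) \<partial>p)"
  proof (rule nn_integral_monotone_convergence_SUP)
    show "incseq (\<lambda>m x. ennreal (?f m x))"
      using f by (auto simp: incseq_def le_fun_def intro!: ennreal_leI)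
        (auto simp: indicator_def)
  qed auto
  also have "\<dots> \<le> ennreal c"
  proof (rule SUP_least)
    fix m
    have "(\<integral>\<^sup>+x. ennreal (?f m x) \<partial>p) = ennreal (measure_pmf.expectation p (?f m))"
      by (rule nn_integral_eq_integral[OF f_int]) (simp add: f)
    also have "\<dots> \<le> ennreal c" by (intro ennreal_leI truncated)
    finally show "(\<integral>\<^sup>+x. ennreal (?f m x) \<partial>p) \<le> ennreal c" .
  qed
  finally have nn: "(\<integral>\<^sup>+x. ennreal (f x) \<partial>p) \<le> ennreal c" .
  show int: "integrable p f"
  proof (rule integrableI_bounded)
    have "(\<integral>\<^sup>+x. ennreal (norm (f x)) \<partial>p) = (\<integral>\<^sup>+x. ennreal (f x) \<partial>p)"
      using f by (intro nn_integral_cong) simp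
    also have "\<dots> < \<infinity>" using nn by (metis ennreal_less_top infinity_ennreal_def le_less_trans)
    finally show "(\<integral>\<^sup>+x. ennreal (norm (f x)) \<partial>p) < \<infinity>" .
  qed simp
  show "measure_pmf.expectation p f \<le> c"
    using nn nn_integral_eq_integral[OF int] f c by (simp add: ennreal_le_iff)
qed

section \<open>One slot of the system and the drift of the spread\<close>

definition pow2_noise ::
  "bool \<Rightarrow> (nat ^ 'n) pmf \<Rightarrow> nat pmf \<Rightarrow> ((nat ^ 'n) \<times> nat \<times> ('n \<times> 'n) \<times> bool) pmf" where
  "pow2_noise wr \<sigma> \<alpha> =
     pair_pmf \<sigma> (pair_pmf \<alpha>
       (pair_pmf (pmf_of_set (candidate_pairs wr)) (bernoulli_pmf (1 / 2))))"

text \<open>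
  Subtraction of natural numbers truncates at zero, so it performs the maximum in the dynamics.
\<close>

definition pow2_step ::
  "nat ^ 'n \<Rightarrow> (nat ^ 'n) \<times> nat \<times> ('n \<times> 'n) \<times> bool \<Rightarrow> nat ^ 'n" where
  "pow2_step x w =
     (case w of (v, b, p, c) \<Rightarrow>
        \<chi> i. x $ i + (if i = shorter_queue x p c then b else 0) - v $ i)"

text \<open>
  What a slot would add to the queues if they were allowed to become negative.
\<close>

definition pow2_increment ::
  "nat ^ 'n \<Rightarrow> (nat ^ 'n) \<times> nat \<times> ('n \<times> 'n) \<times> bool \<Rightarrow> real ^ 'n" where
  "pow2_increment x w =
     (case w of (v, b, p, c) \<Rightarrow>
        \<chi> i. (if i = shorter_queue x p c then real b else 0) - real (v $ i))"

definition spread :: "real ^ 'n \<Rightarrow> real" where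
  "spread y = (\<Sum>i\<in>UNIV. \<Sum>j\<in>UNIV. \<bar>y $ i - y $ j\<bar>)"

definition spread2 :: "real ^ 'n \<Rightarrow> real" where
  "spread2 y = (\<Sum>i\<in>UNIV. \<Sum>j\<in>UNIV. (y $ i - y $ j)\<^sup>2)"

lemma spread_nonneg: "spread y \<ge> 0"
  by (simp add: spread_def sum_nonneg)

lemma spread2_nonneg: "spread2 y \<ge> 0"
  by (simp add: spread2_def sum_nonneg)

lemma spread2_le_spread_squared: "spread2 y \<le> (spread y)\<^sup>2"
proof -
  have "spread2 y = (\<Sum>p\<in>UNIV. (\<bar>y $ fst p - y $ snd p\<bar>)\<^sup>2)"
    by (simp add: spread2_def sum.cartesian_product case_prod_unfold)
  also have "\<dots> \<le> (\<Sum>p\<in>UNIV. \<bar>y $ fst p - y $ snd p\<bar>)\<^sup>2"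
    unfolding power2_eq_square sum_product
    by (intro sum_mono member_le_sum) auto
  also have "(\<Sum>p\<in>UNIV. \<bar>y $ fst p - y $ snd p\<bar>) = spread y"
    by (simp add: spread_def sum.cartesian_product case_prod_unfold)
  finally show ?thesis .
qed

lemma spread_squared_le_spread2:
  fixes y :: "real ^ 'n"
  shows "(spread y)\<^sup>2 \<le> (real CARD('n))\<^sup>2 * spread2 y"
proof -
  have "(\<Sum>p\<in>UNIV. \<bar>y $ fst p - y $ snd p\<bar>)\<^sup>2
      \<le> (\<Sum>p\<in>UNIV. (\<bar>y $ fst p - y $ snd p\<bar>)\<^sup>2) * real (card (UNIV :: ('n \<times> 'n) set))"
    by (rule sum_squared_le_sum_of_squares)
  then show ?thesis
    by (simp add: spread_def spread2_def sum.cartesian_product case_prod_unfold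
        power2_eq_square mult_ac)
qed

lemma spread2_add:
  "spread2 (y + z) =
     spread2 y + 2 * (\<Sum>i\<in>UNIV. \<Sum>j\<in>UNIV. (y $ i - y $ j) * (z $ i - z $ j)) + spread2 z"
  by (simp add: spread2_def sum_distrib_left sum.distrib[symmetric] power2_eq_square algebra_simps)

lemma sum_differences_product:
  fixes y z :: "real ^ 'n"
  shows "(\<Sum>i\<in>UNIV. \<Sum>j\<in>UNIV. (y $ i - y $ j) * (z $ i - z $ j)) =
     2 * real CARD('n) * (\<Sum>i\<in>UNIV. y $ i * z $ i) - 2 * (\<Sum>i\<in>UNIV. y $ i) * (\<Sum>i\<in>UNIV. z $ i)"
proof -
  have "(\<Sum>i\<in>UNIV. \<Sum>j\<in>UNIV. (y $ i - y $ j) * (z $ i - z $ j)) =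
      (\<Sum>i\<in>UNIV. \<Sum>j::'n\<in>UNIV. y $ i * z $ i) + (\<Sum>i::'n\<in>UNIV. \<Sum>j\<in>UNIV. y $ j * z $ j)
      - (\<Sum>i\<in>UNIV. \<Sum>j\<in>UNIV. y $ i * z $ j) - (\<Sum>i\<in>UNIV. \<Sum>j\<in>UNIV. y $ j * z $ i)"
    unfolding sum.distrib[symmetric] sum_subtractf[symmetric]
    by (intro sum.cong refl) (simp add: algebra_simps)
  also have "(\<Sum>i\<in>UNIV. \<Sum>j\<in>UNIV. y $ j * z $ i) = (\<Sum>i\<in>UNIV. \<Sum>j\<in>UNIV. y $ i * z $ j)"
    by (rule sum.swap)
  also have "(\<Sum>i\<in>UNIV. \<Sum>j\<in>UNIV. y $ i * z $ j) = (\<Sum>i\<in>UNIV. y $ i) * (\<Sum>i\<in>UNIV. z $ i)"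
    by (simp add: sum_product)
  also have "(\<Sum>i\<in>UNIV. \<Sum>j::'n\<in>UNIV. y $ i * z $ i) = real CARD('n) * (\<Sum>i\<in>UNIV. y $ i * z $ i)"
    by (simp add: sum_distrib_left)
  finally show ?thesis by simp
qed

lemma pow2_step_eq_max:
  "real_vec (pow2_step x w) $ i = max ((real_vec x + pow2_increment x w) $ i) 0"
  by (auto simp: pow2_step_def pow2_increment_def real_vec_def split: prod.splits)

text \<open>
  Cutting all queues off at zero is 1-Lipschitz, hence it cannot spread them further apart; unused
  service may therefore be ignored in the drift of \<open>spread2\<close>.
\<close>

lemma spread2_step_le:
  "spread2 (real_vec (pow2_step x w)) \<le> spread2 (real_vec x + pow2_increment x w)"
proof -
  have "(max a 0 - max b 0)\<^sup>2 \<le> (a - b)\<^sup>2" for a b :: real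
    by (subst abs_le_square_iff[symmetric]) (auto simp: max_def)
  then show ?thesis
    unfolding spread2_def pow2_step_eq_max by (intro sum_mono)
qed

lemma shorter_queue_min:
  "real (x $ shorter_queue x (i, j) c) = (real (x $ i) + real (x $ j) - \<bar>real (x $ i) - real (x $ j)\<bar>) / 2"
  by (auto simp: shorter_queue_def)

lemma card_candidate_pairs_le: "card (candidate_pairs wr :: ('n::finite \<times> 'n) set) \<le> CARD('n)\<^sup>2"
proof -
  have "card (candidate_pairs wr :: ('n::finite \<times> 'n) set) \<le> card (UNIV :: ('n \<times> 'n) set)"
    by (intro card_mono) auto
  then show ?thesis by (simp add: power2_eq_square)
qed

text \<open>
  Under both drawing conventions each of the two candidates is uniformly distributed.
\<close>

lemma sum_candidate_pairs_endpoints: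
  fixes y :: "real ^ 'n"
  shows "(\<Sum>(i, j)\<in>candidate_pairs wr. y $ i + y $ j) * real CARD('n) =
    2 * real (card (candidate_pairs wr :: ('n \<times> 'n) set)) * (\<Sum>i\<in>UNIV. y $ i)"
proof -
  let ?n = "real CARD('n)" and ?D = "{p :: 'n \<times> 'n. fst p = snd p}"
  have D: "?D = (\<lambda>i. (i, i)) ` UNIV" by auto
  have cardD: "card ?D = CARD('n)"
    unfolding D by (subst card_image) (auto simp: inj_on_def)
  have sumD: "(\<Sum>(i, j)\<in>?D. y $ i + y $ j) = 2 * (\<Sum>i\<in>UNIV. y $ i)"
    unfolding D by (subst sum.reindex) (auto simp: inj_on_def sum_distrib_left)
  have all: "(\<Sum>(i, j)\<in>UNIV. y $ i + y $ j) = 2 * ?n * (\<Sum>i\<in>UNIV. y $ i)"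
    unfolding UNIV_Times_UNIV[symmetric] sum.cartesian_product[symmetric]
    by (simp add: sum.distrib sum_distrib_left mult.assoc)
  show ?thesis
  proof (cases wr)
    case True
    then show ?thesis by (simp add: candidate_pairs_def all)
  next
    case False
    then have eq: "candidate_pairs wr = UNIV - ?D" by (auto simp: candidate_pairs_def)
    have c: "real (card (UNIV - ?D)) = ?n * ?n - ?n"
      by (subst card_Diff_subset) (auto simp: cardD of_nat_diff)
    have s: "(\<Sum>(i, j)\<in>UNIV - ?D. y $ i + y $ j) = 2 * ?n * (\<Sum>i\<in>UNIV. y $ i) - 2 * (\<Sum>i\<in>UNIV. y $ i)"
      by (subst sum_diff) (auto simp: all sumD)
    show ?thesis unfolding eq c s by (simp add: algebra_simps)
  qed
qed

text \<open>
  The minimum of two numbers is their mean minus half of their distance.  Averaged over the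
  candidate pairs, the means give the average queue length and the distances give \<open>spread\<close>, divided
  by the number of pairs, which is at most \<open>n\<^sup>2\<close>.
\<close>

lemma expected_shorter_queue_le:
  fixes x :: "nat ^ 'n"
  assumes "candidate_pairs wr \<noteq> ({} :: ('n \<times> 'n) set)"
  shows "measure_pmf.expectation
      (pair_pmf (pmf_of_set (candidate_pairs wr)) (bernoulli_pmf (1 / 2)))
      (\<lambda>z. real (x $ shorter_queue x (fst z) (snd z)))
    \<le> (\<Sum>i\<in>UNIV. real (x $ i)) / real CARD('n) - spread (real_vec x) / (2 * (real CARD('n))\<^sup>2)"
proof -
  let ?n = "real CARD('n)" and ?P = "candidate_pairs wr :: ('n \<times> 'n) set"
  let ?y = "real_vec x"
  define m where "m = (\<lambda>(i, j). (?y $ i + ?y $ j - \<bar>?y $ i - ?y $ j\<bar>) / 2)"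
  have fin: "finite ?P" by simp
  have card: "0 < real (card ?P)" "real (card ?P) \<le> ?n\<^sup>2"
    using assms card_candidate_pairs_le[where 'n = 'n, of wr]
    by (auto simp: card_gt_0_iff simp flip: of_nat_power of_nat_le_iff)
  have m: "real (x $ shorter_queue x (fst z) (snd z)) = m (fst z)" for z
    using shorter_queue_min[of x "fst (fst z)" "snd (fst z)"]
    by (simp add: m_def case_prod_unfold real_vec_def)
  have "measure_pmf.expectation (pair_pmf (pmf_of_set ?P) (bernoulli_pmf (1 / 2)))
      (\<lambda>z. real (x $ shorter_queue x (fst z) (snd z))) = sum m ?P / real (card ?P)"
    unfolding m expectation_pair_pmf_fst by (rule integral_pmf_of_set[OF assms fin])
  also have "sum m ?P = ((\<Sum>(i, j)\<in>?P. ?y $ i + ?y $ j) - (\<Sum>(i, j)\<in>?P. \<bar>?y $ i - ?y $ j\<bar>)) / 2"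
    unfolding m_def by (simp add: case_prod_unfold sum_subtractf sum_divide_distrib[symmetric])
  also have "(\<Sum>(i, j)\<in>?P. \<bar>?y $ i - ?y $ j\<bar>) = spread ?y"
  proof -
    have "(\<Sum>(i, j)\<in>?P. \<bar>?y $ i - ?y $ j\<bar>) = (\<Sum>(i, j)\<in>UNIV. \<bar>?y $ i - ?y $ j\<bar>)"
      by (rule sum.mono_neutral_left) (auto simp: candidate_pairs_def split: if_splits)
    then show ?thesis by (simp add: spread_def sum.cartesian_product)
  qed
  also have "(\<Sum>(i, j)\<in>?P. ?y $ i + ?y $ j) = 2 * real (card ?P) * (\<Sum>i\<in>UNIV. ?y $ i) / ?n"
    using sum_candidate_pairs_endpoints[of ?y wr] by (simp add: field_simps)
  also have "(2 * real (card ?P) * (\<Sum>i\<in>UNIV. ?y $ i) / ?n - spread ?y) / 2 / real (card ?P) =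
      (\<Sum>i\<in>UNIV. ?y $ i) / ?n - spread ?y / (2 * real (card ?P))"
    using assms by (simp add: diff_divide_distrib)
  also have "\<dots> \<le> (\<Sum>i\<in>UNIV. ?y $ i) / ?n - spread ?y / (2 * ?n\<^sup>2)"
    using card spread_nonneg[of ?y] by (intro diff_left_mono divide_left_mono) auto
  finally show ?thesis by (simp add: real_vec_def)
qed

text \<open>
  The system in one steady state, reduced to laws on countable types: \<open>\<sigma>\<close> is the law of the
  potential services in a slot, \<open>\<alpha>\<close> that of the arrivals and \<open>\<pi>\<close> that of the queues.
\<close>

locale stationary_power_of_two =
  fixes wr :: bool and B \<mu> eps :: real
    and \<sigma> :: "(nat ^ 'n) pmf" and \<alpha> :: "nat pmf" and \<pi> :: "(nat ^ 'n) pmf"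
  assumes candidates: "candidate_pairs wr \<noteq> ({} :: ('n \<times> 'n) set)"
    and service_le: "v \<in> set_pmf \<sigma> \<Longrightarrow> real (v $ i) \<le> B"
    and arrival_le: "b \<in> set_pmf \<alpha> \<Longrightarrow> real b \<le> B"
    and service_mean: "measure_pmf.expectation \<sigma> (\<lambda>v. real (v $ i)) = \<mu>"
    and arrival_mean: "measure_pmf.expectation \<alpha> real = real CARD('n) * \<mu> - eps"
    and stationary: "map_pmf (\<lambda>z. pow2_step (fst z) (snd z)) (pair_pmf \<pi> (pow2_noise wr \<sigma> \<alpha>)) = \<pi>"
begin

abbreviation \<nu> :: "((nat ^ 'n) \<times> nat \<times> ('n \<times> 'n) \<times> bool) pmf" where
  "\<nu> \<equiv> pow2_noise wr \<sigma> \<alpha>"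

lemma B_nonneg: "B \<ge> 0"
  by (meson arrival_le order_trans of_nat_0_le_iff set_pmf_not_empty all_not_in_conv)

lemma finite_services: "finite (set_pmf \<sigma>)"
proof (rule finite_subset)
  show "set_pmf \<sigma> \<subseteq> vec_lambda ` PiE UNIV (\<lambda>_. {..nat \<lceil>B\<rceil>})"
  proof
    fix v assume v: "v \<in> set_pmf \<sigma>"
    have "v $ i \<le> nat \<lceil>B\<rceil>" for i
      using service_le[OF v, of i] by linarith
    then have "vec_nth v \<in> PiE UNIV (\<lambda>_. {..nat \<lceil>B\<rceil>})" by auto
    then have "vec_lambda (vec_nth v) \<in> vec_lambda ` PiE UNIV (\<lambda>_. {..nat \<lceil>B\<rceil>})"
      by (rule imageI)
    then show "v \<in> vec_lambda ` PiE UNIV (\<lambda>_. {..nat \<lceil>B\<rceil>})" by simp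
  qed
  show "finite (vec_lambda ` PiE (UNIV :: 'n set) (\<lambda>_. {..nat \<lceil>B\<rceil>}))"
    by (intro finite_imageI finite_PiE) auto
qed

lemma finite_arrivals: "finite (set_pmf \<alpha>)"
proof (rule finite_subset)
  show "set_pmf \<alpha> \<subseteq> {..nat \<lceil>B\<rceil>}"
  proof
    fix b assume "b \<in> set_pmf \<alpha>"
    from arrival_le[OF this] have "b \<le> nat \<lceil>B\<rceil>" by linarith
    then show "b \<in> {..nat \<lceil>B\<rceil>}" by simp
  qed
qed simp

lemma finite_noise: "finite (set_pmf \<nu>)"
  unfolding pow2_noise_def set_pair_pmf
  using finite_services finite_arrivals candidates
  by (intro finite_cartesian_product) (auto intro: finite_subset[OF subset_UNIV])

lemma integrable_noise [simp]:
  fixes f :: "_ \<Rightarrow> 'c::{banach, second_countable_topology}"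
  shows "integrable \<nu> f"
  using finite_noise by (rule integrable_measure_pmf_finite)

lemma expectation_service: "measure_pmf.expectation \<nu> (\<lambda>w. real (fst w $ i)) = \<mu>"
  unfolding pow2_noise_def by (subst expectation_pair_pmf_fst) (rule service_mean)

lemma expectation_arrival: "measure_pmf.expectation \<nu> (\<lambda>w. real (fst (snd w))) = real CARD('n) * \<mu> - eps"
  unfolding pow2_noise_def
  by (subst expectation_pair_pmf_snd, subst expectation_pair_pmf_fst) (rule arrival_mean)

lemma increment_abs_le:
  assumes "w \<in> set_pmf \<nu>"
  shows "\<bar>pow2_increment x w $ i\<bar> \<le> B"
proof -
  obtain v b p c where w: "w = (v, b, p, c)" by (cases w) auto
  have "real (v $ i) \<le> B" "real b \<le> B" using assms by (auto simp: w pow2_noise_def service_le arrival_le)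
  then show ?thesis using B_nonneg by (auto simp: w pow2_increment_def)
qed

text \<open>
  The double sum equals \<open>2n\<close> times the inner product of \<open>x\<close>, centred at its average, with the
  increment.  The services have equal means, so they are orthogonal in mean to the centred \<open>x\<close>; what is
  left is the arrival rate times the mean deficit of the chosen queue below the average.
\<close>

lemma expected_cross_term:
  assumes rate: "0 \<le> real CARD('n) * \<mu> - eps"
  shows "measure_pmf.expectation \<nu> (\<lambda>w. \<Sum>i\<in>UNIV. \<Sum>j\<in>UNIV.
      (real_vec x $ i - real_vec x $ j) * (pow2_increment x w $ i - pow2_increment x w $ j))
    \<le> - (real CARD('n) * \<mu> - eps) * spread (real_vec x) / real CARD('n)"
proof -
  let ?X = "\<Sum>i\<in>UNIV. real (x $ i)" and ?rate = "real CARD('n) * \<mu> - eps"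
  let ?short = "\<lambda>z. real (x $ shorter_queue x (fst z) (snd z))"
  have eq: "(\<Sum>i\<in>UNIV. \<Sum>j\<in>UNIV.
      (real_vec x $ i - real_vec x $ j) * (pow2_increment x w $ i - pow2_increment x w $ j)) =
      2 * real CARD('n) * (real (fst (snd w)) * ?short (snd (snd w)) - (\<Sum>i\<in>UNIV. real (x $ i) * real (fst w $ i)))
      - 2 * ?X * (real (fst (snd w)) - (\<Sum>i\<in>UNIV. real (fst w $ i)))" for w
  proof -
    obtain v b p c where w: "w = (v, b, p, c)" by (cases w) auto
    have "(\<Sum>i\<in>UNIV. real (x $ i) * ((if i = shorter_queue x p c then real b else 0) - real (v $ i))) =
        real b * real (x $ shorter_queue x p c) - (\<Sum>i\<in>UNIV. real (x $ i) * real (v $ i))"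
    proof -
      have "(\<Sum>i\<in>UNIV. real (x $ i) * (if i = shorter_queue x p c then real b else 0)) =
          (\<Sum>i\<in>UNIV. if i = shorter_queue x p c then real b * real (x $ i) else 0)"
        by (intro sum.cong refl) auto
      then show ?thesis by (simp add: right_diff_distrib sum_subtractf)
    qed
    moreover have "(\<Sum>i\<in>UNIV. (if i = shorter_queue x p c then real b else 0) - real (v $ i)) =
        real b - (\<Sum>i\<in>UNIV. real (v $ i))"
      by (simp add: sum_subtractf)
    ultimately show ?thesis
      unfolding sum_differences_product by (simp add: w pow2_increment_def real_vec_def)
  qed
  define m where "m = measure_pmf.expectation
    (pair_pmf (pmf_of_set (candidate_pairs wr)) (bernoulli_pmf (1 / 2))) ?short"
  have short: "measure_pmf.expectation \<nu> (\<lambda>w. real (fst (snd w)) * ?short (snd (snd w))) = ?rate * m"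
    unfolding pow2_noise_def m_def arrival_mean[symmetric]
    by (subst expectation_pair_pmf_snd[where f = "\<lambda>z. real (fst z) * ?short (snd z)"],
        rule expectation_pair_pmf_times)
       (auto intro!: integrable_measure_pmf_finite finite_arrivals finite_cartesian_product
         intro: finite_subset[OF subset_UNIV])
  have "measure_pmf.expectation \<nu> (\<lambda>w. \<Sum>i\<in>UNIV. \<Sum>j\<in>UNIV.
      (real_vec x $ i - real_vec x $ j) * (pow2_increment x w $ i - pow2_increment x w $ j)) =
      2 * real CARD('n) * (?rate * m - (\<Sum>i\<in>UNIV. real (x $ i) * \<mu>)) - 2 * ?X * (?rate - (\<Sum>i::'n\<in>UNIV. \<mu>))"
    unfolding eq
    by (simp add: short expectation_service expectation_arrival)
  also have "\<dots> = 2 * real CARD('n) * ?rate * (m - ?X / real CARD('n))"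
    by (simp add: sum_distrib_right[symmetric] field_simps) (simp add: sum_distrib_left)
  also have "\<dots> \<le> 2 * real CARD('n) * ?rate * (- spread (real_vec x) / (2 * (real CARD('n))\<^sup>2))"
    using expected_shorter_queue_le[OF candidates, of x] rate
    by (intro mult_left_mono) (auto simp: m_def)
  also have "\<dots> = - ?rate * spread (real_vec x) / real CARD('n)"
    by (simp add: field_simps power2_eq_square)
  finally show ?thesis .
qed

end

section \<open>State-space collapse\<close>

lemma cubic_dominates_square:
  fixes t :: real
  assumes "c > 0" "G \<ge> 0" "t \<ge> 0"
  shows "- c * t ^ 3 + G * t\<^sup>2 \<le> - t\<^sup>2 + (G + 1) * ((G + 1) / c)\<^sup>2"
\<comment> \<open>at the threshold \<open>c t\<^sup>3\<close> and \<open>(G + 1) t\<^sup>2\<close> agree\<close>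
proof (cases "t \<ge> (G + 1) / c")
  case True
  then have "G + 1 \<le> c * t" using assms by (simp add: field_simps)
  then have "(G + 1) * t\<^sup>2 \<le> c * t * t\<^sup>2" by (intro mult_right_mono) auto
  moreover have "0 \<le> (G + 1) * ((G + 1) / c)\<^sup>2" using assms by simp
  ultimately show ?thesis by (simp add: power3_eq_cube power2_eq_square algebra_simps)
next
  case False
  then have "t\<^sup>2 \<le> ((G + 1) / c)\<^sup>2" using assms by (intro power_mono) auto
  then have "(G + 1) * t\<^sup>2 \<le> (G + 1) * ((G + 1) / c)\<^sup>2"
    using assms by (intro mult_left_mono) auto
  moreover have "0 \<le> c * t ^ 3" using assms by simp
  ultimately show ?thesis by (simp add: algebra_simps)
qed

text \<open>
  Here \<open>C\<close> bounds \<open>spread2\<close> of an increment, \<open>G\<close> is the coefficient of \<open>D\<^sup>2\<close> in the drift of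
  \<open>spread2\<close> squared, and \<open>4 \<rho> / n\<^sup>3\<close> is the coefficient of the negative term in \<open>D\<^sup>3\<close>, where \<open>\<rho>\<close> is a
  lower bound on the arrival rate.
\<close>

definition collapse_bound :: "real \<Rightarrow> real \<Rightarrow> real \<Rightarrow> real" where
  "collapse_bound n B \<rho> =
     (let C = 4 * n\<^sup>2 * B\<^sup>2; G = 2 * C + 32 * B\<^sup>2 in
      (G + 1) * ((G + 1) / (4 * \<rho> / n ^ 3))\<^sup>2 + 2 * C\<^sup>2)"

context stationary_power_of_two
begin

lemma cross_term_abs_le:
  assumes "w \<in> set_pmf \<nu>"
  shows "\<bar>\<Sum>i\<in>UNIV. \<Sum>j\<in>UNIV.
      (y $ i - y $ j) * (pow2_increment x w $ i - pow2_increment x w $ j)\<bar> \<le> 2 * B * spread y"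
proof -
  have "\<bar>\<Sum>i\<in>UNIV. \<Sum>j\<in>UNIV. (y $ i - y $ j) * (pow2_increment x w $ i - pow2_increment x w $ j)\<bar>
      \<le> (\<Sum>i\<in>UNIV. \<Sum>j\<in>UNIV. \<bar>(y $ i - y $ j) * (pow2_increment x w $ i - pow2_increment x w $ j)\<bar>)"
    by (rule order_trans[OF sum_abs sum_mono[OF sum_abs]])
  also have "\<dots> \<le> (\<Sum>i\<in>UNIV. \<Sum>j\<in>UNIV. \<bar>y $ i - y $ j\<bar> * (2 * B))"
  proof (intro sum_mono)
    fix i j
    have "\<bar>pow2_increment x w $ i - pow2_increment x w $ j\<bar> \<le> 2 * B"
      using increment_abs_le[OF assms, of x i] increment_abs_le[OF assms, of x j] by linarith
    then show "\<bar>(y $ i - y $ j) * (pow2_increment x w $ i - pow2_increment x w $ j)\<bar>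
        \<le> \<bar>y $ i - y $ j\<bar> * (2 * B)"
      unfolding abs_mult by (rule mult_left_mono) simp
  qed
  also have "\<dots> = 2 * B * spread y"
    by (simp add: spread_def sum_distrib_left sum_distrib_right mult_ac)
  finally show ?thesis .
qed

lemma spread2_increment_le:
  assumes "w \<in> set_pmf \<nu>"
  shows "spread2 (pow2_increment x w) \<le> 4 * (real CARD('n))\<^sup>2 * B\<^sup>2"
proof -
  have "spread2 (pow2_increment x w) \<le> (\<Sum>i::'n\<in>UNIV. \<Sum>j::'n\<in>UNIV. (2 * B)\<^sup>2)"
    unfolding spread2_def
  proof (intro sum_mono)
    fix i j
    have "\<bar>pow2_increment x w $ i - pow2_increment x w $ j\<bar> \<le> 2 * B"
      using increment_abs_le[OF assms, of x i] increment_abs_le[OF assms, of x j] by linarith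
    then show "(pow2_increment x w $ i - pow2_increment x w $ j)\<^sup>2 \<le> (2 * B)\<^sup>2"
      using power_mono[OF _ abs_ge_zero, of _ "2 * B" 2] by simp
  qed
  then show ?thesis by (simp add: power2_eq_square mult_ac)
qed

text \<open>
  With \<open>W = spread2\<close>, a slot changes \<open>W\<close> by at most \<open>2 L + z\<close>, where the cross term \<open>L\<close> has mean
  of order \<open>- D\<close> and size of order \<open>D\<close>, and \<open>z\<close> is bounded.  Using \<open>W\<^sup>2\<close> instead of \<open>W\<close> multiplies the
  drift by \<open>W\<close>, which is of order \<open>D\<^sup>2\<close>; the drift of \<open>W\<close> itself would control only the first moment
  of \<open>D\<close>, and the error term in the transform identity needs the second.
\<close>

lemma spread_drift:
  assumes rate: "0 < \<rho>" "\<rho> \<le> real CARD('n) * \<mu> - eps"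
  shows "measure_pmf.expectation \<nu> (\<lambda>w. (spread2 (real_vec (pow2_step x w)))\<^sup>2)
    \<le> (spread2 (real_vec x))\<^sup>2 - (spread (real_vec x))\<^sup>2 + collapse_bound (real CARD('n)) B \<rho>"
proof -
  let ?n = "real CARD('n)" and ?r = "real CARD('n) * \<mu> - eps"
  let ?W = "spread2 (real_vec x)" and ?D = "spread (real_vec x)"
  define L where "L w = (\<Sum>i\<in>UNIV. \<Sum>j\<in>UNIV.
      (real_vec x $ i - real_vec x $ j) * (pow2_increment x w $ i - pow2_increment x w $ j))" for w
  define C where "C = 4 * ?n\<^sup>2 * B\<^sup>2"
  define G where "G = 2 * C + 32 * B\<^sup>2"
  have n: "?n > 0" by simp
  have C: "C \<ge> 0" and G: "G \<ge> 0" by (simp_all add: C_def G_def)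
  have D: "?D \<ge> 0" and W: "?W \<ge> 0" by (simp_all add: spread_nonneg spread2_nonneg)
  have pointwise: "(spread2 (real_vec (pow2_step x w)))\<^sup>2
      \<le> ?W\<^sup>2 + 4 * ?W * L w + 2 * ?W * C + (4 * B * ?D + C)\<^sup>2" if w: "w \<in> set_pmf \<nu>" for w
  proof -
    let ?z = "spread2 (pow2_increment x w)"
    have z: "0 \<le> ?z" "?z \<le> C"
      using spread2_increment_le[OF w, of x] by (simp_all add: spread2_nonneg C_def)
    have "(spread2 (real_vec (pow2_step x w)))\<^sup>2 \<le> (?W + 2 * L w + ?z)\<^sup>2"
      using spread2_step_le[of x w] unfolding spread2_add L_def[symmetric]
      by (intro power_mono) (auto simp: spread2_nonneg)
    also have "\<dots> = ?W\<^sup>2 + 4 * ?W * L w + 2 * ?W * ?z + (2 * L w + ?z)\<^sup>2"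
      by (simp add: power2_eq_square algebra_simps)
    also have "\<dots> \<le> ?W\<^sup>2 + 4 * ?W * L w + 2 * ?W * C + (4 * B * ?D + C)\<^sup>2"
    proof (intro add_mono order_refl mult_left_mono)
      have "\<bar>2 * L w + ?z\<bar> \<le> 4 * B * ?D + C"
        using cross_term_abs_le[OF w, of "real_vec x" x] z unfolding L_def[symmetric] by linarith
      then show "(2 * L w + ?z)\<^sup>2 \<le> (4 * B * ?D + C)\<^sup>2"
        using power_mono[OF _ abs_ge_zero, of "2 * L w + ?z" _ 2] by simp
    qed (use z W in auto)
    finally show ?thesis .
  qed
  have "measure_pmf.expectation \<nu> (\<lambda>w. (spread2 (real_vec (pow2_step x w)))\<^sup>2)
      \<le> measure_pmf.expectation \<nu> (\<lambda>w. ?W\<^sup>2 + 4 * ?W * L w + 2 * ?W * C + (4 * B * ?D + C)\<^sup>2)"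
    by (intro integral_mono_AE) (auto simp: AE_measure_pmf_iff intro: pointwise)
  also have "\<dots> = ?W\<^sup>2 + 4 * ?W * measure_pmf.expectation \<nu> L + 2 * ?W * C + (4 * B * ?D + C)\<^sup>2"
    by simp
  also have "4 * ?W * measure_pmf.expectation \<nu> L \<le> 4 * (?D\<^sup>2 / ?n\<^sup>2) * (- \<rho> * ?D / ?n)"
  proof -
    have "measure_pmf.expectation \<nu> L \<le> - ?r * ?D / ?n"
      using rate unfolding L_def by (intro expected_cross_term) auto
    also have "\<dots> \<le> - \<rho> * ?D / ?n"
      using rate D by (intro divide_right_mono mult_right_mono) auto
    finally have "4 * ?W * measure_pmf.expectation \<nu> L \<le> 4 * ?W * (- \<rho> * ?D / ?n)"
      using W by (intro mult_left_mono) auto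
    also have "\<dots> \<le> 4 * (?D\<^sup>2 / ?n\<^sup>2) * (- \<rho> * ?D / ?n)"
      using spread_squared_le_spread2[of "real_vec x"] rate D n
      by (intro mult_right_mono_neg mult_left_mono) (auto simp: field_simps)
    finally show ?thesis .
  qed
  also have "4 * (?D\<^sup>2 / ?n\<^sup>2) * (- \<rho> * ?D / ?n) = - (4 * \<rho> / ?n ^ 3) * ?D ^ 3"
    by (simp add: power2_eq_square power3_eq_cube)
  also have "2 * ?W * C \<le> 2 * ?D\<^sup>2 * C"
    using spread2_le_spread_squared[of "real_vec x"] C by (intro mult_right_mono) auto
  also have "(4 * B * ?D + C)\<^sup>2 \<le> 32 * B\<^sup>2 * ?D\<^sup>2 + 2 * C\<^sup>2"
    using zero_le_power2[of "4 * B * ?D - C"] by (simp add: power2_eq_square algebra_simps)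
  finally have "measure_pmf.expectation \<nu> (\<lambda>w. (spread2 (real_vec (pow2_step x w)))\<^sup>2)
      \<le> ?W\<^sup>2 + (- (4 * \<rho> / ?n ^ 3) * ?D ^ 3 + G * ?D\<^sup>2) + 2 * C\<^sup>2"
    by (simp add: G_def algebra_simps)
  also have "- (4 * \<rho> / ?n ^ 3) * ?D ^ 3 + G * ?D\<^sup>2
      \<le> - ?D\<^sup>2 + (G + 1) * ((G + 1) / (4 * \<rho> / ?n ^ 3))\<^sup>2"
    using rate n G D by (intro cubic_dominates_square) auto
  finally show ?thesis
    by (simp add: collapse_bound_def Let_def C_def[symmetric] G_def[symmetric])
qed

text \<open>
  The bound depends on the system only through \<open>n\<close>, \<open>B\<close> and \<open>\<rho>\<close>, so it is uniform in heavy traffic,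
  whereas the queue lengths themselves blow up.
\<close>

lemma state_space_collapse:
  assumes rate: "0 < \<rho>" "\<rho> \<le> real CARD('n) * \<mu> - eps"
  shows "integrable \<pi> (\<lambda>x. (spread (real_vec x))\<^sup>2)"
    and "measure_pmf.expectation \<pi> (\<lambda>x. (spread (real_vec x))\<^sup>2) \<le> collapse_bound (real CARD('n)) B \<rho>"
proof -
  have "collapse_bound (real CARD('n)) B \<rho> \<ge> 0"
    by (simp add: collapse_bound_def Let_def)
  then show "integrable \<pi> (\<lambda>x. (spread (real_vec x))\<^sup>2)"
    and "measure_pmf.expectation \<pi> (\<lambda>x. (spread (real_vec x))\<^sup>2) \<le> collapse_bound (real CARD('n)) B \<rho>"
    using stationary_drift_bound[OF stationary finite_noise, of "\<lambda>x. (spread2 (real_vec x))\<^sup>2"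
        "\<lambda>x. (spread (real_vec x))\<^sup>2", OF _ _ _ spread_drift[OF rate]] by auto
qed

end

section \<open>Unused service and the transform identity\<close>

definition total_queue :: "nat ^ 'n \<Rightarrow> real" where
  "total_queue x = (\<Sum>i\<in>UNIV. real (x $ i))"

definition net_flow :: "(nat ^ 'n) \<times> nat \<times> ('n \<times> 'n) \<times> bool \<Rightarrow> real" where
  "net_flow w = real (fst (snd w)) - total_queue (fst w)"

definition unused :: "nat ^ 'n \<Rightarrow> (nat ^ 'n) \<times> nat \<times> ('n \<times> 'n) \<times> bool \<Rightarrow> real" where
  "unused x w = (\<Sum>i\<in>UNIV. max (- (real_vec x + pow2_increment x w) $ i) 0)"

definition total_char :: "(nat ^ 'n) pmf \<Rightarrow> real \<Rightarrow> complex" where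
  "total_char p \<tau> = measure_pmf.expectation p (\<lambda>x. iexp (\<tau> * total_queue x))"

definition flow_char :: "((nat ^ 'n) \<times> nat \<times> ('n \<times> 'n) \<times> bool) pmf \<Rightarrow> real \<Rightarrow> complex" where
  "flow_char p \<tau> = measure_pmf.expectation p (\<lambda>w. iexp (\<tau> * net_flow w))"

lemma total_queue_nonneg: "total_queue x \<ge> 0"
  by (simp add: total_queue_def sum_nonneg)

lemma unused_nonneg: "unused x w \<ge> 0"
  by (simp add: unused_def sum_nonneg)

lemma sum_increment: "(\<Sum>i\<in>UNIV. pow2_increment x w $ i) = net_flow w"
proof -
  obtain v b p c where w: "w = (v, b, p, c)" by (cases w) auto
  have "(\<Sum>i\<in>UNIV. pow2_increment x w $ i) =
      (\<Sum>i\<in>UNIV. (if i = shorter_queue x p c then real b else 0) - real (v $ i))"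
    by (rule sum.cong) (simp_all add: w pow2_increment_def)
  also have "\<dots> = net_flow w"
    by (simp add: w net_flow_def total_queue_def sum_subtractf)
  finally show ?thesis .
qed

lemma total_step: "total_queue (pow2_step x w) = total_queue x + net_flow w + unused x w"
proof -
  have "total_queue (pow2_step x w) = (\<Sum>i\<in>UNIV. max ((real_vec x + pow2_increment x w) $ i) 0)"
    unfolding total_queue_def pow2_step_eq_max[symmetric] by (simp add: real_vec_def)
  also have "\<dots> = (\<Sum>i\<in>UNIV. (real_vec x + pow2_increment x w) $ i +
      max (- (real_vec x + pow2_increment x w) $ i) 0)"
    by (intro sum.cong refl) (auto simp: max_def)
  also have "\<dots> = total_queue x + net_flow w + unused x w"
    unfolding sum_increment[of x w, symmetric]
    by (simp add: sum.distrib unused_def total_queue_def real_vec_def)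
  finally show ?thesis .
qed

text \<open>
  A queue that wastes service is empty at the end of the slot, so its distances to the other queues
  add up to the total queue length.
\<close>

lemma total_times_unused_le:
  "total_queue (pow2_step x w) * unused x w \<le> spread (real_vec (pow2_step x w)) * unused x w"
proof -
  let ?y = "real_vec x + pow2_increment x w" and ?x' = "pow2_step x w"
  have "total_queue ?x' * max (- ?y $ j) 0 \<le> spread (real_vec ?x') * max (- ?y $ j) 0" for j
  proof (cases "?y $ j < 0")
    case True
    then have zero: "real_vec ?x' $ j = 0" by (simp add: pow2_step_eq_max)
    have "total_queue ?x' = (\<Sum>i\<in>UNIV. \<bar>real_vec ?x' $ i - real_vec ?x' $ j\<bar>)"
      unfolding zero by (simp add: total_queue_def real_vec_def)
    also have "\<dots> \<le> (\<Sum>j\<in>UNIV. \<Sum>i\<in>UNIV. \<bar>real_vec ?x' $ i - real_vec ?x' $ j\<bar>)"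
      by (rule member_le_sum) (auto intro: sum_nonneg)
    also have "\<dots> = spread (real_vec ?x')"
      unfolding spread_def by (rule sum.swap)
    finally show ?thesis by (rule mult_right_mono) simp
  next
    case False
    then show ?thesis by simp
  qed
  then show ?thesis
    unfolding unused_def sum_distrib_left by (intro sum_mono)
qed

text \<open>
  Replacing the product by \<open>- i\<tau>u\<close> costs a second-order term in \<open>u\<close> and a mixed term
  \<open>\<tau>\<^sup>2 N u\<close>.  The mixed term is split by \<open>2 D u \<le> s D\<^sup>2 + u\<^sup>2 / s\<close> with a weight \<open>s\<close> to be chosen.
\<close>

lemma transform_error_le:
  fixes \<tau> N u D C s :: real
  assumes N: "0 \<le> N" and u: "0 \<le> u" "u \<le> C" and Nu: "N * u \<le> D * u" and s: "s > 0"
  shows "norm (iexp (\<tau> * N) * (iexp (- \<tau> * u) - 1) + \<i> * complex_of_real (\<tau> * u))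
    \<le> \<tau>\<^sup>2 * ((C + C / s) * u + s * D\<^sup>2) / 2"
proof -
  have uu: "u\<^sup>2 \<le> C * u"
    using u by (simp add: power2_eq_square mult_right_mono)
  have a: "norm (iexp (- \<tau> * u) - 1 + \<i> * complex_of_real (\<tau> * u)) \<le> \<tau>\<^sup>2 * u\<^sup>2 / 2"
    using iexp_approx1[of "- \<tau> * u" 1] by (simp add: power_mult_distrib power2_eq_square algebra_simps)
  have b: "norm (iexp (\<tau> * N) - 1) \<le> \<bar>\<tau>\<bar> * N"
    using iexp_approx1[of "\<tau> * N" 0] N by (simp add: abs_mult)
  have "iexp (\<tau> * N) * (iexp (- \<tau> * u) - 1) + \<i> * complex_of_real (\<tau> * u) =
      iexp (\<tau> * N) * (iexp (- \<tau> * u) - 1 + \<i> * complex_of_real (\<tau> * u))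
      - (iexp (\<tau> * N) - 1) * (\<i> * complex_of_real (\<tau> * u))"
    by (simp add: algebra_simps)
  then have "norm (iexp (\<tau> * N) * (iexp (- \<tau> * u) - 1) + \<i> * complex_of_real (\<tau> * u)) \<le>
      norm (iexp (\<tau> * N) * (iexp (- \<tau> * u) - 1 + \<i> * complex_of_real (\<tau> * u)))
      + norm ((iexp (\<tau> * N) - 1) * (\<i> * complex_of_real (\<tau> * u)))"
    using norm_triangle_ineq4 by metis
  also have "\<dots> = norm (iexp (- \<tau> * u) - 1 + \<i> * complex_of_real (\<tau> * u))
      + norm (iexp (\<tau> * N) - 1) * (\<bar>\<tau>\<bar> * u)"
    using u by (simp only: norm_mult norm_of_real norm_exp_i_times norm_ii abs_mult abs_of_nonneg mult_1_left)
  also have "\<dots> \<le> \<tau>\<^sup>2 * u\<^sup>2 / 2 + (\<bar>\<tau>\<bar> * N) * (\<bar>\<tau>\<bar> * u)"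
    using u by (intro add_mono a mult_right_mono b) simp
  also have "\<dots> = \<tau>\<^sup>2 * (u\<^sup>2 + 2 * (N * u)) / 2"
  proof -
    have "(\<bar>\<tau>\<bar> * N) * (\<bar>\<tau>\<bar> * u) = \<tau>\<^sup>2 * (N * u)" by (simp add: power2_eq_square)
    then show ?thesis by (simp add: algebra_simps)
  qed
  also have "\<dots> \<le> \<tau>\<^sup>2 * (C * u + (s * D\<^sup>2 + C * u / s)) / 2"
  proof (intro divide_right_mono mult_left_mono add_mono uu)
    have "2 * (N * u) \<le> 2 * (D * u)" using Nu by simp
    also have "\<dots> \<le> s * D\<^sup>2 + u\<^sup>2 / s"
    proof -
      have "0 \<le> (s * D - u)\<^sup>2 / s" using s by simp
      then show ?thesis using s by (simp add: power2_eq_square field_simps)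
    qed
    also have "\<dots> \<le> s * D\<^sup>2 + C * u / s"
      using uu s by (intro add_left_mono divide_right_mono) auto
    finally show "2 * (N * u) \<le> s * D\<^sup>2 + C * u / s" .
  qed auto
  also have "\<dots> = \<tau>\<^sup>2 * ((C + C / s) * u + s * D\<^sup>2) / 2" by (simp add: algebra_simps)
  finally show ?thesis .
qed

context stationary_power_of_two
begin

lemma net_flow_abs_le:
  assumes "w \<in> set_pmf \<nu>"
  shows "\<bar>net_flow w\<bar> \<le> real CARD('n) * B"
proof -
  have "\<bar>net_flow w\<bar> \<le> (\<Sum>i\<in>UNIV. \<bar>pow2_increment 0 w $ i\<bar>)"
    unfolding sum_increment[of 0, symmetric] by (rule sum_abs)
  also have "\<dots> \<le> (\<Sum>i::'n\<in>UNIV. B)"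
    by (intro sum_mono increment_abs_le assms)
  finally show ?thesis by simp
qed

lemma unused_le:
  assumes "w \<in> set_pmf \<nu>"
  shows "unused x w \<le> real CARD('n) * B"
proof -
  have "unused x w \<le> (\<Sum>i::'n\<in>UNIV. B)"
    unfolding unused_def
  proof (intro sum_mono)
    fix i
    have "0 \<le> real_vec x $ i" by (simp add: real_vec_def)
    then show "max (- (real_vec x + pow2_increment x w) $ i) 0 \<le> B"
      using increment_abs_le[OF assms, of x i] B_nonneg by (simp add: abs_le_iff)
  qed
  then show ?thesis by simp
qed

lemma expectation_net_flow: "measure_pmf.expectation \<nu> net_flow = - eps"
proof -
  have "measure_pmf.expectation \<nu> net_flow =
      measure_pmf.expectation \<nu> (\<lambda>w. real (fst (snd w))) -
      (\<Sum>i\<in>UNIV. measure_pmf.expectation \<nu> (\<lambda>w. real (fst w $ i)))"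
    by (simp add: net_flow_def[abs_def] total_queue_def)
  then show ?thesis by (simp add: expectation_arrival expectation_service)
qed

lemma in_noise_if_in_pair: "z \<in> set_pmf (pair_pmf \<pi> \<nu>) \<Longrightarrow> snd z \<in> set_pmf \<nu>"
  by auto

lemma integrable_unused: "integrable (pair_pmf \<pi> \<nu>) (\<lambda>z. unused (fst z) (snd z))"
proof (intro integrable_pmf_bounded[where B = "real CARD('n) * B"])
  fix z assume "z \<in> set_pmf (pair_pmf \<pi> \<nu>)"
  from unused_le[OF in_noise_if_in_pair[OF this], of "fst z"]
  show "norm (unused (fst z) (snd z)) \<le> real CARD('n) * B"
    by (simp add: unused_nonneg)
qed

text \<open>
  In steady state the mean unused service compensates the mean net flow.
\<close>

lemma expectation_unused:
  "measure_pmf.expectation (pair_pmf \<pi> \<nu>) (\<lambda>z. unused (fst z) (snd z)) = eps"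
proof -
  let ?p = "pair_pmf \<pi> \<nu>"
  have int: "integrable ?p (\<lambda>z. net_flow (snd z))"
    using net_flow_abs_le[OF in_noise_if_in_pair]
    by (intro integrable_pmf_bounded[where B = "real CARD('n) * B"]) simp
  have "measure_pmf.expectation ?p (\<lambda>z. total_queue (pow2_step (fst z) (snd z)) - total_queue (fst z)) = 0"
  proof (rule expectation_difference_equal_laws)
    have "map_pmf (\<lambda>z. total_queue (pow2_step (fst z) (snd z))) ?p =
        map_pmf total_queue (map_pmf (\<lambda>z. pow2_step (fst z) (snd z)) ?p)"
      by (simp add: pmf.map_comp o_def)
    also have "\<dots> = map_pmf total_queue (map_pmf fst ?p)"
      by (simp add: stationary map_fst_pair_pmf)
    finally show "map_pmf (\<lambda>z. total_queue (pow2_step (fst z) (snd z))) ?p = map_pmf (\<lambda>z. total_queue (fst z)) ?p"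
      by (simp add: pmf.map_comp o_def)
    show "\<bar>total_queue (pow2_step (fst z) (snd z)) - total_queue (fst z)\<bar> \<le> 2 * (real CARD('n) * B)"
      if "z \<in> set_pmf ?p" for z
      using net_flow_abs_le[OF in_noise_if_in_pair[OF that]] unused_nonneg[of "fst z" "snd z"]
        unused_le[OF in_noise_if_in_pair[OF that], of "fst z"]
      unfolding total_step by linarith
  qed (simp_all add: total_queue_nonneg)
  then have "measure_pmf.expectation ?p (\<lambda>z. net_flow (snd z)) +
      measure_pmf.expectation ?p (\<lambda>z. unused (fst z) (snd z)) = 0"
    using int integrable_unused by (simp add: total_step algebra_simps)
  then show ?thesis
    by (simp add: expectation_net_flow)
qed

text \<open>
  Both sides are the difference of the expectations of \<open>e^(i\<tau>(N' - u))\<close> and of \<open>e^(i\<tau>N')\<close>, where \<open>N'\<close> is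
  the total after the slot: \<open>N' - u\<close> is the old total plus the independent net flow, and \<open>N'\<close> has the law
  of the old total.
\<close>

lemma transform_identity:
  "total_char \<pi> \<tau> * (flow_char \<nu> \<tau> - 1) = measure_pmf.expectation (pair_pmf \<pi> \<nu>)
     (\<lambda>z. iexp (\<tau> * total_queue (pow2_step (fst z) (snd z))) * (iexp (- \<tau> * unused (fst z) (snd z)) - 1))"
proof -
  let ?p = "pair_pmf \<pi> \<nu>"
  let ?N' = "\<lambda>z. total_queue (pow2_step (fst z) (snd z))"
  have int: "integrable ?p (\<lambda>z. iexp (g z))" for g :: "_ \<Rightarrow> real"
    by (intro integrable_pmf_bounded[where B = 1]) simp
  have "total_char \<pi> \<tau> * flow_char \<nu> \<tau> =
      measure_pmf.expectation ?p (\<lambda>z. iexp (\<tau> * total_queue (fst z)) * iexp (\<tau> * net_flow (snd z)))"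
    unfolding total_char_def flow_char_def
    by (rule expectation_pair_pmf_times[symmetric])
       (intro integrable_pmf_bounded[where B = 1], simp add: norm_mult)
  also have "\<dots> = measure_pmf.expectation ?p (\<lambda>z. iexp (\<tau> * ?N' z + - \<tau> * unused (fst z) (snd z)))"
    by (intro integral_cong_AE) (auto simp: total_step algebra_simps exp_add[symmetric])
  finally have 1: "total_char \<pi> \<tau> * flow_char \<nu> \<tau> =
      measure_pmf.expectation ?p (\<lambda>z. iexp (\<tau> * ?N' z + - \<tau> * unused (fst z) (snd z)))" .
  have 2: "total_char \<pi> \<tau> = measure_pmf.expectation ?p (\<lambda>z. iexp (\<tau> * ?N' z))"
    unfolding total_char_def by (subst stationary[symmetric]) simp
  have "total_char \<pi> \<tau> * (flow_char \<nu> \<tau> - 1) = measure_pmf.expectation ?p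
      (\<lambda>z. iexp (\<tau> * ?N' z + - \<tau> * unused (fst z) (snd z)) - iexp (\<tau> * ?N' z))"
    by (subst Bochner_Integration.integral_diff[OF int int]) (simp only: right_diff_distrib mult_1_right 1 2[symmetric])
  also have "\<dots> = measure_pmf.expectation ?p
      (\<lambda>z. iexp (\<tau> * ?N' z) * (iexp (- \<tau> * unused (fst z) (snd z)) - 1))"
    by (intro integral_cong_AE) (auto simp: algebra_simps exp_add[symmetric])
  finally show ?thesis .
qed

text \<open>
  The weight in \<open>transform_error_le\<close> is \<open>sqrt eps\<close>.  The unused service has mean \<open>eps\<close> and
  \<open>D\<^sup>2\<close> has bounded mean, so this choice makes both halves of the mixed term of order \<open>sqrt eps\<close>.
\<close>

lemma transform_boundary_term:
  assumes rate: "0 < \<rho>" "\<rho> \<le> real CARD('n) * \<mu> - eps" and eps: "eps > 0"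
  shows "norm (total_char \<pi> \<tau> * (flow_char \<nu> \<tau> - 1) + \<i> * (\<tau> * eps)) \<le> \<tau>\<^sup>2 *
    ((real CARD('n) * B) * eps + sqrt eps * (collapse_bound (real CARD('n)) B \<rho> + real CARD('n) * B)) / 2"
proof -
  let ?p = "pair_pmf \<pi> \<nu>"
  let ?x' = "\<lambda>z. pow2_step (fst z) (snd z)"
  let ?C = "real CARD('n) * B" and ?K = "collapse_bound (real CARD('n)) B \<rho>"
  define u where "u z = unused (fst z) (snd z)" for z :: "(nat ^ 'n) \<times> _"
  define D where "D z = spread (real_vec (?x' z))" for z :: "(nat ^ 'n) \<times> _"
  define g where "g z = iexp (\<tau> * total_queue (?x' z)) * (iexp (- \<tau> * u z) - 1)"
    for z :: "(nat ^ 'n) \<times> _"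
  define h where "h z = \<tau>\<^sup>2 * ((?C + ?C / sqrt eps) * u z + sqrt eps * (D z)\<^sup>2) / 2" for z
  have s: "sqrt eps > 0" using eps by simp
  have D_int: "integrable ?p (\<lambda>z. (D z)\<^sup>2)" and D_le: "measure_pmf.expectation ?p (\<lambda>z. (D z)\<^sup>2) \<le> ?K"
  proof -
    have "integrable (map_pmf ?x' ?p) (\<lambda>x. (spread (real_vec x))\<^sup>2)"
      unfolding stationary by (rule state_space_collapse[OF rate])
    then show "integrable ?p (\<lambda>z. (D z)\<^sup>2)" by (simp add: D_def)
    have "measure_pmf.expectation (map_pmf ?x' ?p) (\<lambda>x. (spread (real_vec x))\<^sup>2) \<le> ?K"
      unfolding stationary by (rule state_space_collapse[OF rate])
    then show "measure_pmf.expectation ?p (\<lambda>z. (D z)\<^sup>2) \<le> ?K" by (simp add: D_def)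
  qed
  have g_int: "integrable ?p g"
  proof (intro integrable_pmf_bounded[where B = 2])
    fix z
    have "norm (iexp (- \<tau> * u z) - 1) \<le> norm (iexp (- \<tau> * u z)) + norm (1 :: complex)"
      by (rule norm_triangle_ineq4)
    then show "norm (g z) \<le> 2" by (simp add: norm_mult g_def)
  qed
  have u_int: "integrable ?p u"
    unfolding u_def[abs_def] by (rule integrable_unused)
  have u_mean: "measure_pmf.expectation ?p u = eps"
    unfolding u_def[abs_def] by (rule expectation_unused)
  have cu_int: "integrable ?p (\<lambda>z. \<i> * complex_of_real (\<tau> * u z))"
    using u_int by simp
  have h_int: "integrable ?p h"
    unfolding h_def[abs_def] using u_int D_int by simp
  have gu_int: "integrable ?p (\<lambda>z. g z + \<i> * complex_of_real (\<tau> * u z))"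
    by (rule Bochner_Integration.integrable_add[OF g_int cu_int])
  have "total_char \<pi> \<tau> * (flow_char \<nu> \<tau> - 1) + \<i> * (\<tau> * eps) =
      measure_pmf.expectation ?p g + measure_pmf.expectation ?p (\<lambda>z. \<i> * complex_of_real (\<tau> * u z))"
    unfolding transform_identity g_def[abs_def] u_mean[symmetric] by (simp add: u_def[abs_def])
  also have "\<dots> = measure_pmf.expectation ?p (\<lambda>z. g z + \<i> * complex_of_real (\<tau> * u z))"
    by (rule Bochner_Integration.integral_add[OF g_int cu_int, symmetric])
  also have "norm \<dots> \<le> measure_pmf.expectation ?p h"
  proof (rule norm_expectation_pmf_le[OF gu_int h_int])
    fix z assume z: "z \<in> set_pmf ?p"
    show "norm (g z + \<i> * complex_of_real (\<tau> * u z)) \<le> h z"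
      unfolding g_def h_def
    proof (rule transform_error_le)
      show "0 \<le> u z" "u z \<le> ?C"
        unfolding u_def using unused_nonneg unused_le[OF in_noise_if_in_pair[OF z]] .
      show "total_queue (?x' z) * u z \<le> D z * u z"
        unfolding u_def D_def by (rule total_times_unused_le)
    qed (simp_all add: total_queue_nonneg eps)
  qed
  also have "\<dots> = \<tau>\<^sup>2 * ((?C + ?C / sqrt eps) * eps + sqrt eps * measure_pmf.expectation ?p (\<lambda>z. (D z)\<^sup>2)) / 2"
    unfolding h_def[abs_def] using D_int u_int by (simp add: u_mean)
  also have "\<dots> \<le> \<tau>\<^sup>2 * ((?C + ?C / sqrt eps) * eps + sqrt eps * ?K) / 2"
    using D_le s by (intro divide_right_mono mult_left_mono add_left_mono) auto
  also have "(?C + ?C / sqrt eps) * eps = ?C * eps + sqrt eps * ?C"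
  proof -
    have "?C / sqrt eps * eps = ?C * (eps / sqrt eps)" by simp
    also have "eps / sqrt eps = sqrt eps" using eps by (simp add: real_div_sqrt)
    finally show ?thesis by (simp only: distrib_right mult.commute[of "sqrt eps"])
  qed
  also have "?C * eps + sqrt eps * ?C + sqrt eps * ?K = ?C * eps + sqrt eps * (?K + ?C)"
    by (simp only: distrib_left add_ac)
  finally show ?thesis .
qed

text \<open>
  Second-order Taylor expansion of the characteristic function of the net flow, which has mean
  \<open>- eps\<close>; the remainder is of third order because the net flow is bounded.
\<close>

lemma flow_char_expansion:
  "norm (flow_char \<nu> \<tau> - 1 + \<i> * (\<tau> * eps) + \<tau>\<^sup>2 * measure_pmf.expectation \<nu> (\<lambda>w. (net_flow w)\<^sup>2) / 2)
    \<le> \<bar>\<tau>\<bar> ^ 3 * (real CARD('n) * B) ^ 3 / 6"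
proof -
  let ?d = "\<lambda>w. \<tau> * net_flow w"
  have "flow_char \<nu> \<tau> - 1 + \<i> * (\<tau> * eps) + \<tau>\<^sup>2 * measure_pmf.expectation \<nu> (\<lambda>w. (net_flow w)\<^sup>2) / 2 =
      measure_pmf.expectation \<nu> (\<lambda>w. iexp (?d w) - 1 - \<i> * ?d w + of_real ((?d w)\<^sup>2) / 2)"
  proof -
    have "measure_pmf.expectation \<nu> (\<lambda>w. (complex_of_real (net_flow w))\<^sup>2) =
        of_real (measure_pmf.expectation \<nu> (\<lambda>w. (net_flow w)\<^sup>2))"
      by (simp flip: of_real_power)
    then show ?thesis by (simp add: flow_char_def expectation_net_flow power_mult_distrib)
  qed
  also have "norm \<dots> \<le> measure_pmf.expectation \<nu> (\<lambda>w. \<bar>\<tau>\<bar> ^ 3 * (real CARD('n) * B) ^ 3 / 6)"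
  proof (rule norm_expectation_pmf_le)
    fix w assume w: "w \<in> set_pmf \<nu>"
    have "norm (iexp (?d w) - (\<Sum>k\<le>2. (\<i> * ?d w) ^ k / fact k)) \<le> \<bar>?d w\<bar> ^ Suc 2 / fact (Suc 2)"
      by (rule iexp_approx1)
    also have "(\<Sum>k\<le>2. (\<i> * ?d w) ^ k / fact k) = 1 + \<i> * ?d w - of_real ((?d w)\<^sup>2) / 2"
      by (simp add: numeral_2_eq_2 power2_eq_square algebra_simps)
    also have "\<bar>?d w\<bar> ^ Suc 2 / fact (Suc 2) \<le> \<bar>\<tau>\<bar> ^ 3 * (real CARD('n) * B) ^ 3 / 6"
    proof -
      have "\<bar>net_flow w\<bar> ^ 3 \<le> (real CARD('n) * B) ^ 3"
        using net_flow_abs_le[OF w] by (rule power_mono) simp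
      then have "\<bar>\<tau>\<bar> ^ 3 * \<bar>net_flow w\<bar> ^ 3 \<le> \<bar>\<tau>\<bar> ^ 3 * (real CARD('n) * B) ^ 3"
        by (rule mult_left_mono) simp
      moreover have "(fact (Suc 2) :: real) = 6" "Suc 2 = 3" by (simp_all add: eval_nat_numeral)
      ultimately show ?thesis by (simp add: abs_mult power_mult_distrib del: fact_Suc)
    qed
    finally show "norm (iexp (?d w) - 1 - \<i> * ?d w + of_real ((?d w)\<^sup>2) / 2) \<le> \<bar>\<tau>\<bar> ^ 3 * (real CARD('n) * B) ^ 3 / 6"
      by (simp add: algebra_simps)
  qed auto
  finally show ?thesis by simp
qed

text \<open>
  The net flow is the centred arrivals minus the centred total service minus \<open>eps\<close>, and arrivals are
  independent of services, so all mixed terms vanish in the mean.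
\<close>

lemma expectation_net_flow_squared:
  "measure_pmf.expectation \<nu> (\<lambda>w. (net_flow w)\<^sup>2) =
     measure_pmf.variance \<alpha> real +
     (\<Sum>i\<in>UNIV. \<Sum>j\<in>UNIV.
        measure_pmf.expectation \<sigma> (\<lambda>v. (real (v $ i) - \<mu>) * (real (v $ j) - \<mu>))) + eps\<^sup>2"
proof -
  define S where "S v = (\<Sum>i\<in>UNIV. real (v $ i) - \<mu>)" for v :: "nat ^ 'n"
  define A where "A b = real b - measure_pmf.expectation \<alpha> real" for b :: nat
  have \<alpha>_int [simp]: "integrable \<alpha> f" for f :: "nat \<Rightarrow> real"
    by (rule integrable_measure_pmf_finite[OF finite_arrivals])
  have \<sigma>_int [simp]: "integrable \<sigma> f" for f :: "nat ^ 'n \<Rightarrow> real"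
    by (rule integrable_measure_pmf_finite[OF finite_services])
  have arr: "measure_pmf.expectation \<nu> (\<lambda>w. f (fst (snd w))) = measure_pmf.expectation \<alpha> f" for f :: "nat \<Rightarrow> real"
    unfolding pow2_noise_def by (subst expectation_pair_pmf_snd, subst expectation_pair_pmf_fst) (rule refl)
  have serv: "measure_pmf.expectation \<nu> (\<lambda>w. f (fst w)) = measure_pmf.expectation \<sigma> f" for f :: "nat ^ 'n \<Rightarrow> real"
    unfolding pow2_noise_def by (rule expectation_pair_pmf_fst)
  have A0: "measure_pmf.expectation \<alpha> A = 0"
    by (simp add: A_def[abs_def])
  have S0: "measure_pmf.expectation \<sigma> S = 0"
    by (simp add: S_def[abs_def] service_mean)
  have AS: "measure_pmf.expectation \<nu> (\<lambda>w. S (fst w) * A (fst (snd w))) = 0"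
  proof -
    have "measure_pmf.expectation \<nu> (\<lambda>w. S (fst w) * A (fst (snd w))) =
        measure_pmf.expectation \<sigma> S * measure_pmf.expectation
          (pair_pmf \<alpha> (pair_pmf (pmf_of_set (candidate_pairs wr :: ('n \<times> 'n) set)) (bernoulli_pmf (1 / 2)))) (\<lambda>y. A (fst y))"
      unfolding pow2_noise_def
      by (rule expectation_pair_pmf_times[where f = S and g = "\<lambda>y. A (fst y)"])
         (rule integrable_noise[unfolded pow2_noise_def])
    then show ?thesis by (simp add: S0)
  qed
  have "(net_flow w)\<^sup>2 = (A (fst (snd w)))\<^sup>2 + (S (fst w))\<^sup>2 + eps\<^sup>2
      - 2 * (S (fst w) * A (fst (snd w))) - 2 * eps * A (fst (snd w)) + 2 * eps * S (fst w)" for w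
  proof -
    have "net_flow w = A (fst (snd w)) - S (fst w) - eps"
      by (simp add: net_flow_def total_queue_def A_def S_def arrival_mean sum_subtractf)
    then show ?thesis by (simp only:) (simp add: power2_eq_square algebra_simps)
  qed
  then have "measure_pmf.expectation \<nu> (\<lambda>w. (net_flow w)\<^sup>2) =
      measure_pmf.expectation \<alpha> (\<lambda>b. (A b)\<^sup>2) + measure_pmf.expectation \<sigma> (\<lambda>v. (S v)\<^sup>2) + eps\<^sup>2"
    by (simp add: AS A0 S0 arr[of A] serv[of S] arr[of "\<lambda>b. (A b)\<^sup>2"] serv[of "\<lambda>v. (S v)\<^sup>2"])
  also have "measure_pmf.expectation \<sigma> (\<lambda>v. (S v)\<^sup>2) = (\<Sum>i\<in>UNIV. \<Sum>j\<in>UNIV.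
        measure_pmf.expectation \<sigma> (\<lambda>v. (real (v $ i) - \<mu>) * (real (v $ j) - \<mu>)))"
    unfolding S_def power2_eq_square sum_product
    by (simp only: Bochner_Integration.integral_sum \<sigma>_int)
  finally show ?thesis by (simp add: A_def)
qed

end

section \<open>The steady state as a stationary law of the chain\<close>

definition law_pmf :: "'a measure \<Rightarrow> ('a \<Rightarrow> 'b) \<Rightarrow> 'b pmf" where
  "law_pmf M X = Abs_pmf (distr M (count_space UNIV) X)"

lemma measure_law_pmf:
  fixes X :: "'a \<Rightarrow> 'b::countable"
  assumes "prob_space M" "X \<in> M \<rightarrow>\<^sub>M count_space UNIV"
  shows "measure_pmf (law_pmf M X) = distr M (count_space UNIV) X"
  unfolding law_pmf_def
proof (rule Abs_pmf_inverse, safe)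
  let ?D = "distr M (count_space UNIV) X"
  interpret D: prob_space ?D by (rule prob_space.prob_space_distr[OF assms])
  show "prob_space ?D" by (rule D.prob_space_axioms)
  show "AE x in ?D. measure ?D {x} \<noteq> 0"
    by (subst D.AE_support_countable) (auto intro!: exI[of _ UNIV])
qed auto

lemma expectation_law_pmf:
  fixes X :: "'a \<Rightarrow> 'b::countable" and f :: "'b \<Rightarrow> 'c::{banach, second_countable_topology}"
  assumes "prob_space M" "X \<in> M \<rightarrow>\<^sub>M count_space UNIV"
  shows "measure_pmf.expectation (law_pmf M X) f = (\<integral>\<omega>. f (X \<omega>) \<partial>M)"
  unfolding measure_law_pmf[OF assms] using assms by (subst integral_distr) auto

lemma pmf_law_pmf:
  fixes X :: "'a \<Rightarrow> 'b::countable"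
  assumes "prob_space M" "X \<in> M \<rightarrow>\<^sub>M count_space UNIV"
  shows "pmf (law_pmf M X) x = measure M (X -` {x} \<inter> space M)"
  unfolding pmf.rep_eq measure_law_pmf[OF assms] using assms by (subst measure_distr) auto

lemma law_pmf_AE:
  fixes X :: "'a \<Rightarrow> 'b::countable"
  assumes "prob_space M" "X \<in> M \<rightarrow>\<^sub>M count_space UNIV" and "AE \<omega> in M. P (X \<omega>)"
    and "x \<in> set_pmf (law_pmf M X)"
  shows "P x"
proof -
  have "AE x in law_pmf M X. P x"
    unfolding measure_law_pmf[OF assms(1,2)] using assms by (subst AE_distr_iff) auto
  then show ?thesis using assms(4) by (simp add: AE_measure_pmf_iff)
qed

lemma law_pmf_eqI:
  assumes "distr M (count_space UNIV) X = measure_pmf p"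
  shows "law_pmf M X = p"
  by (simp add: law_pmf_def assms measure_pmf_inverse)

lemma law_pmf_map:
  fixes X :: "'a \<Rightarrow> 'b::countable" and Y :: "'a \<Rightarrow> 'c::countable"
  assumes "prob_space M" "X \<in> M \<rightarrow>\<^sub>M count_space UNIV"
    and "\<And>\<omega>. \<omega> \<in> space M \<Longrightarrow> Y \<omega> = f (X \<omega>)"
  shows "law_pmf M Y = map_pmf f (law_pmf M X)"
proof (rule law_pmf_eqI)
  have "distr M (count_space UNIV) Y = distr M (count_space UNIV) (\<lambda>\<omega>. f (X \<omega>))"
    using assms by (intro distr_cong) auto
  also have "\<dots> = distr (distr M (count_space UNIV) X) (count_space UNIV) f"
    using assms by (subst distr_distr) (auto simp: o_def)
  finally show "distr M (count_space UNIV) Y = measure_pmf (map_pmf f (law_pmf M X))"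
    by (simp add: map_pmf_rep_eq measure_law_pmf[OF assms(1,2)])
qed

lemma Int_stable_vimages: "Int_stable {X -` A \<inter> \<Omega> | A. True}"
proof (rule Int_stableI)
  fix a b assume "a \<in> {X -` A \<inter> \<Omega> | A. True}" "b \<in> {X -` A \<inter> \<Omega> | A. True}"
  then obtain A B where "a = X -` A \<inter> \<Omega>" "b = X -` B \<inter> \<Omega>" by auto
  then have "a \<inter> b = X -` (A \<inter> B) \<inter> \<Omega>" by auto
  then show "a \<inter> b \<in> {X -` A \<inter> \<Omega> | A. True}" by blast
qed

context power_of_two_system
begin

definition past :: "nat \<Rightarrow> noise set" where
  "past k = {Initial} \<union> (\<Union>l\<in>{1..<k}. {Service l, Arrival l, Candidates l, Coin l})"

abbreviation events_of :: "noise \<Rightarrow> 'a set set" where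
  "events_of \<equiv> noise_events M (q 1) s a cand coin"

lemma q_Suc:
  assumes "k \<ge> 1" "\<omega> \<in> space M"
  shows "q (Suc k) \<omega> = pow2_step (q k \<omega>) (s k \<omega>, a k \<omega>, cand k \<omega>, coin k \<omega>)"
proof (rule vec_eq_iff[THEN iffD2], rule allI)
  fix i
  show "q (Suc k) \<omega> $ i = pow2_step (q k \<omega>) (s k \<omega>, a k \<omega>, cand k \<omega>, coin k \<omega>) $ i"
    using dynamics[OF assms, of i] by (auto simp: pow2_step_def)
qed

text \<open>
  The queues at the start of slot \<open>k\<close> are determined by the initial state and the noise of earlier
  slots.  Everything is countable, so the preimage of a set is a countable union of intersections of
  noise events.
\<close>

lemma q_in_past:
  assumes "k \<ge> 1"
  shows "q k -` A \<inter> space M \<in> sigma_sets (space M) (\<Union>j\<in>past k. events_of j)"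
  using assms
proof (induction k arbitrary: A rule: nat_induct_at_least)
  case base
  show ?case by (rule sigma_sets.Basic) (auto simp: past_def)
next
  case (Suc k)
  let ?G = "\<Union>j\<in>past (Suc k). events_of j"
  have events_subset: "events_of j \<subseteq> Pow (space M)" for j
    by (cases j) auto
  interpret G: sigma_algebra "space M" "sigma_sets (space M) ?G"
    using events_subset by (intro sigma_algebra_sigma_sets) auto
  have past_mono: "past k \<subseteq> past (Suc k)" by (auto simp: past_def)
  have now: "Service k \<in> past (Suc k)" "Arrival k \<in> past (Suc k)"
      "Candidates k \<in> past (Suc k)" "Coin k \<in> past (Suc k)"
    using Suc.hyps by (auto simp: past_def)
  have q_k: "q k -` B \<inter> space M \<in> sigma_sets (space M) ?G" for B
    using Suc.IH[of B] past_mono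
    by (rule_tac subsetD[OF sigma_sets_mono']) (auto intro: UN_mono)
  have in_G: "F \<in> sigma_sets (space M) ?G" if "j \<in> past (Suc k)" "F \<in> events_of j" for j F
    using that by (intro sigma_sets.Basic UN_I)
  have noise_k: "s k -` B1 \<inter> space M \<in> sigma_sets (space M) ?G"
      "a k -` B2 \<inter> space M \<in> sigma_sets (space M) ?G"
      "cand k -` B3 \<inter> space M \<in> sigma_sets (space M) ?G"
      "coin k -` B4 \<inter> space M \<in> sigma_sets (space M) ?G" for B1 B2 B3 B4
    using in_G[OF now(1)] in_G[OF now(2)] in_G[OF now(3)] in_G[OF now(4)]
    unfolding noise_events.simps by blast+
  let ?E = "\<lambda>(x, v, b, p, c). (q k -` {x} \<inter> space M) \<inter> (s k -` {v} \<inter> space M) \<inter>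
      (a k -` {b} \<inter> space M) \<inter> (cand k -` {p} \<inter> space M) \<inter> (coin k -` {c} \<inter> space M)"
  have "q (Suc k) -` A \<inter> space M = (\<Union>z\<in>{z. pow2_step (fst z) (snd z) \<in> A}. ?E z)"
  proof (intro set_eqI iffI)
    fix \<omega> assume \<omega>: "\<omega> \<in> q (Suc k) -` A \<inter> space M"
    show "\<omega> \<in> (\<Union>z\<in>{z. pow2_step (fst z) (snd z) \<in> A}. ?E z)"
      by (rule UN_I[of "(q k \<omega>, s k \<omega>, a k \<omega>, cand k \<omega>, coin k \<omega>)"])
         (use \<omega> q_Suc[OF Suc.hyps, of \<omega>] in simp_all)
  next
    fix \<omega> assume "\<omega> \<in> (\<Union>z\<in>{z. pow2_step (fst z) (snd z) \<in> A}. ?E z)"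
    then obtain z where "pow2_step (fst z) (snd z) \<in> A" "\<omega> \<in> ?E z" by (elim UN_E CollectE)
    moreover obtain x v b p c where "z = (x, v, b, p, c)" by (cases z) auto
    ultimately show "\<omega> \<in> q (Suc k) -` A \<inter> space M"
      using q_Suc[OF Suc.hyps, of \<omega>] by simp
  qed
  also have "\<dots> \<in> sigma_sets (space M) ?G"
  proof (rule G.countable_UN')
    have "?E z \<in> sigma_sets (space M) ?G" for z
    proof -
      obtain x v b p c where z: "z = (x, v, b, p, c)" by (cases z) auto
      show ?thesis unfolding z prod.case by (intro G.Int q_k noise_k)
    qed
    then show "?E ` {z. pow2_step (fst z) (snd z) \<in> A} \<subseteq> sigma_sets (space M) ?G" by blast
  qed simp
  finally show ?case .
qed

lemma q_rv:
  assumes "k \<ge> 1"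
  shows "random_variable (count_space UNIV) (q k)"
proof (rule measurableI)
  fix A
  have "events_of j \<subseteq> events" if "j \<in> past k" for j
    using that q1_rv s_rv a_rv cand_rv coin_rv
    by (cases j) (auto simp: past_def intro!: measurable_sets)
  then have "sigma_sets (space M) (\<Union>j\<in>past k. events_of j) \<subseteq> events"
    by (intro sets.sigma_sets_subset) auto
  then show "q k -` A \<inter> space M \<in> events"
    using q_in_past[OF assms] by auto
qed simp

text \<open>
  The queues are independent of the noise of the present slot, and the four kinds of noise are
  independent of each other: group the independent sources into the past and the four singletons.
\<close>

lemma prob_joint:
  assumes k: "k \<ge> 1"
  shows "prob ((q k -` {x} \<inter> space M) \<inter> (s k -` {v} \<inter> space M) \<inter>
      (a k -` {b} \<inter> space M) \<inter> (cand k -` {p} \<inter> space M) \<inter> (coin k -` {c} \<inter> space M)) =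
    prob (q k -` {x} \<inter> space M) * prob (s k -` {v} \<inter> space M) * prob (a k -` {b} \<inter> space M) *
      prob (cand k -` {p} \<inter> space M) * prob (coin k -` {c} \<inter> space M)"
proof -
  define J where "J = {Initial, Service k, Arrival k, Candidates k, Coin k}"
  define I where "I j = (if j = Initial then past k else {j})" for j
  let ?F = "\<lambda>j. sigma_sets (space M) (\<Union>i\<in>I j. events_of i)"
  have "indep_sets ?F J"
  proof (rule indep_sets_collect_sigma)
    show "indep_sets events_of (\<Union>j\<in>J. I j)"
      by (rule indep_sets_mono_index[OF _ independent]) (use k in \<open>auto simp: J_def I_def past_def\<close>)
    show "Int_stable (events_of i)" for i
      by (cases i) (simp_all only: noise_events.simps Int_stable_vimages)
    show "disjoint_family_on I J"
      by (auto simp: disjoint_family_on_def J_def I_def past_def)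
  qed
  moreover define E where "E j = (case j of
      Initial \<Rightarrow> q k -` {x} \<inter> space M | Service l \<Rightarrow> s k -` {v} \<inter> space M
    | Arrival l \<Rightarrow> a k -` {b} \<inter> space M | Candidates l \<Rightarrow> cand k -` {p} \<inter> space M
    | Coin l \<Rightarrow> coin k -` {c} \<inter> space M)" for j
  have "\<forall>j\<in>J. E j \<in> ?F j"
    using q_in_past[OF k] by (auto simp: J_def I_def E_def intro!: sigma_sets.Basic)
  ultimately have "prob (\<Inter>j\<in>J. E j) = (\<Prod>j\<in>J. prob (E j))"
    by (intro indep_setsD[of ?F J J]) (auto simp: J_def)
  then show ?thesis by (simp add: J_def E_def Int_ac mult_ac)
qed

lemma law_queues_Suc:
  assumes k: "k \<ge> 1"
  shows "law_pmf M (q (Suc k)) = map_pmf (\<lambda>z. pow2_step (fst z) (snd z))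
    (pair_pmf (law_pmf M (q k)) (pow2_noise with_replacement (law_pmf M (s 1)) (law_pmf M (a 1))))"
proof -
  let ?Z = "\<lambda>\<omega>. (q k \<omega>, s k \<omega>, a k \<omega>, cand k \<omega>, coin k \<omega>)"
  have vimage: "?Z -` {(x, v, b, p, c)} \<inter> space M = (q k -` {x} \<inter> space M) \<inter> (s k -` {v} \<inter> space M) \<inter>
      (a k -` {b} \<inter> space M) \<inter> (cand k -` {p} \<inter> space M) \<inter> (coin k -` {c} \<inter> space M)" for x v b p c
    by auto
  have Z: "?Z \<in> M \<rightarrow>\<^sub>M count_space UNIV"
    unfolding measurable_count_space_eq_countable[OF countableI_type]
  proof (safe)
    fix x v b p c
    show "?Z -` {(x, v, b, p, c)} \<inter> space M \<in> events"
      unfolding vimage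
      using q_rv[OF k] s_rv[OF k] a_rv[OF k] cand_rv[OF k] coin_rv[OF k]
      by (intro sets.Int measurable_sets[where A = "count_space UNIV"]) auto
  qed auto
  note laws = prob_space_axioms
  have same: "law_pmf M (s k) = law_pmf M (s 1)" "law_pmf M (a k) = law_pmf M (a 1)"
    by (simp_all add: law_pmf_def s_distr[OF k] a_distr[OF k])
  have "law_pmf M ?Z = pair_pmf (law_pmf M (q k))
      (pow2_noise with_replacement (law_pmf M (s k)) (law_pmf M (a k)))"
  proof (rule pmf_eqI)
    fix z :: "(nat ^ 'n) \<times> (nat ^ 'n) \<times> nat \<times> ('n \<times> 'n) \<times> bool"
    obtain x v b p c where z: "z = (x, v, b, p, c)" by (cases z) auto
    have "pmf (law_pmf M ?Z) z = pmf (law_pmf M (q k)) x * pmf (law_pmf M (s k)) v *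
        pmf (law_pmf M (a k)) b * pmf (law_pmf M (cand k)) p * pmf (law_pmf M (coin k)) c"
      unfolding z
      by (simp only: pmf_law_pmf[OF laws] Z q_rv[OF k] s_rv[OF k] a_rv[OF k] cand_rv[OF k] coin_rv[OF k]
          vimage prob_joint[OF k])
    then show "pmf (law_pmf M ?Z) z = pmf (pair_pmf (law_pmf M (q k))
        (pow2_noise with_replacement (law_pmf M (s k)) (law_pmf M (a k)))) z"
      by (simp add: z pow2_noise_def pmf_pair law_pmf_eqI[OF cand_distr[OF k]] law_pmf_eqI[OF coin_distr[OF k]])
  qed
  moreover have "law_pmf M (q (Suc k)) = map_pmf (\<lambda>z. pow2_step (fst z) (snd z)) (law_pmf M ?Z)"
    by (rule law_pmf_map[OF laws Z]) (simp add: q_Suc[OF k])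
  ultimately show ?thesis by (simp only: same)
qed

end

lemma continuous_on_discrete_vec:
  fixes f :: "nat ^ 'n \<Rightarrow> 'b::topological_space"
  shows "continuous_on UNIV f"
proof -
  have "open S" for S :: "(nat ^ 'n) set"
    unfolding open_vec_def
  proof
    fix x assume "x \<in> S"
    then show "\<exists>A. (\<forall>i. open (A i) \<and> x $ i \<in> A i) \<and> (\<forall>y. (\<forall>i. y $ i \<in> A i) \<longrightarrow> y \<in> S)"
      by (intro exI[of _ "\<lambda>i. {x $ i}"]) (auto simp: vec_eq_iff[symmetric] intro: discrete_topology_class.open_discrete)
  qed
  then show ?thesis by (simp add: continuous_on_open_vimage)
qed

context power_of_two_system
begin

abbreviation noise_law :: "((nat ^ 'n) \<times> nat \<times> ('n \<times> 'n) \<times> bool) pmf" where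
  "noise_law \<equiv> pow2_noise with_replacement (law_pmf M (s 1)) (law_pmf M (a 1))"

text \<open>
  The topology of the state space is discrete, so convergence in distribution passes to the limit
  in \<open>E f(q(k + 1)) = E (K f)(q(k))\<close>, with \<open>K f\<close> the conditional expectation after one slot, for every
  bounded \<open>f\<close>.
\<close>

lemma steady_state_stationary:
  fixes N :: "'b measure" and q_bar :: "'b \<Rightarrow> nat ^ 'n"
  assumes N: "prob_space N" and q_bar: "q_bar \<in> N \<rightarrow>\<^sub>M count_space UNIV"
    and conv: "converges_in_distribution (\<lambda>_. M) q N q_bar sequentially"
  shows "map_pmf (\<lambda>z. pow2_step (fst z) (snd z)) (pair_pmf (law_pmf N q_bar) noise_law) = law_pmf N q_bar"
proof (rule pmf_eqI)
  fix y :: "nat ^ 'n"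
  let ?\<pi> = "law_pmf N q_bar" and ?step = "\<lambda>z. pow2_step (fst z) (snd z)"
  define f where "f x = indicat_real {y} x" for x
  define Kf where "Kf x = measure_pmf.expectation noise_law (\<lambda>w. f (pow2_step x w))" for x
  have f: "\<bar>f x\<bar> \<le> 1" for x by (simp add: f_def)
  have Kf: "\<bar>Kf x\<bar> \<le> 1" for x
    using norm_expectation_pmf_le[of noise_law "\<lambda>w. f (pow2_step x w)" "\<lambda>_. 1"] f
    by (simp add: Kf_def integrable_pmf_bounded[where B = 1])
  have limit: "(\<lambda>k. measure_pmf.expectation (law_pmf M (q (Suc k))) g) \<longlonglongrightarrow> measure_pmf.expectation ?\<pi> g"
    if "\<And>x. \<bar>g x\<bar> \<le> 1" for g :: "nat ^ 'n \<Rightarrow> real"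
  proof -
    have "(\<lambda>k. \<integral>\<omega>. g (q k \<omega>) \<partial>M) \<longlonglongrightarrow> (\<integral>\<omega>. g (q_bar \<omega>) \<partial>N)"
      using conv continuous_on_discrete_vec that
      unfolding converges_in_distribution_def bounded_iff by auto
    then have "(\<lambda>k. \<integral>\<omega>. g (q (Suc k) \<omega>) \<partial>M) \<longlonglongrightarrow> (\<integral>\<omega>. g (q_bar \<omega>) \<partial>N)"
      by (rule LIMSEQ_Suc)
    then show ?thesis
      by (simp add: expectation_law_pmf prob_space_axioms q_rv N q_bar)
  qed
  have pair: "measure_pmf.expectation (map_pmf ?step (pair_pmf \<rho> noise_law)) f = measure_pmf.expectation \<rho> Kf"
    for \<rho> :: "(nat ^ 'n) pmf"
  proof -
    have "integrable (pair_pmf \<rho> noise_law) (\<lambda>z. f (?step z))"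
      using f by (intro integrable_pmf_bounded[where B = 1]) simp
    then show ?thesis by (simp add: expectation_pair_pmf Kf_def[abs_def])
  qed
  have "(\<lambda>k. measure_pmf.expectation (law_pmf M (q (Suc (Suc k)))) f) \<longlonglongrightarrow> measure_pmf.expectation ?\<pi> f"
    by (rule LIMSEQ_Suc[OF limit[of f]]) (rule f)
  moreover have "measure_pmf.expectation (law_pmf M (q (Suc (Suc k)))) f =
      measure_pmf.expectation (law_pmf M (q (Suc k))) Kf" for k
    by (subst law_queues_Suc) (simp, rule pair)
  ultimately have "measure_pmf.expectation ?\<pi> f = measure_pmf.expectation ?\<pi> Kf"
    using limit[of Kf] Kf by (simp add: LIMSEQ_unique)
  also have "\<dots> = measure_pmf.expectation (map_pmf ?step (pair_pmf ?\<pi> noise_law)) f"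
    by (rule pair[symmetric])
  finally show "pmf (map_pmf ?step (pair_pmf ?\<pi> noise_law)) y = pmf ?\<pi> y"
    by (simp add: f_def[abs_def] pmf.rep_eq)
qed

lemma service_rate_identical:
  assumes "identical_servers M s"
  shows "service_rate M s i = total_service_rate M s / real CARD('n)"
proof -
  have rv: "(\<lambda>\<omega>. s 1 \<omega> $ i) \<in> M \<rightarrow>\<^sub>M count_space UNIV" for i
    using measurable_comp[OF s_rv[of 1], of "\<lambda>v. v $ i"] by (simp add: o_def)
  have "service_rate M s i = (\<integral>x. real x \<partial>distr M (count_space UNIV) (\<lambda>\<omega>. s 1 \<omega> $ i))" for i
    unfolding service_rate_def using rv by (subst integral_distr) auto
  then have "service_rate M s j = service_rate M s i" for i j
    using assms unfolding identical_servers_def by metis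
  then have "total_service_rate M s = (\<Sum>j::'n\<in>UNIV. service_rate M s i)"
    unfolding total_service_rate_def by (intro sum.cong refl)
  then show ?thesis by simp
qed

lemma steady_state_model:
  fixes N :: "'b measure" and q_bar :: "'b \<Rightarrow> nat ^ 'n"
  assumes "prob_space N" "q_bar \<in> N \<rightarrow>\<^sub>M count_space UNIV"
    and "converges_in_distribution (\<lambda>_. M) q N q_bar sequentially"
    and identical: "identical_servers M s"
  shows "stationary_power_of_two with_replacement (max A_max S_max)
    (total_service_rate M s / real CARD('n)) eps (law_pmf M (s 1)) (law_pmf M (a 1)) (law_pmf N q_bar)"
proof
  note s1 = prob_space_axioms s_rv[OF order_refl] and a1 = prob_space_axioms a_rv[OF order_refl]
  show "candidate_pairs with_replacement \<noteq> ({} :: ('n \<times> 'n) set)" by (rule candidates_exist)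
  show "real (v $ i) \<le> max A_max S_max" if "v \<in> set_pmf (law_pmf M (s 1))" for v i
    using law_pmf_AE[OF s1 s_bounded[OF order_refl, of i] that] by (simp add: le_max_iff_disj)
  show "real b \<le> max A_max S_max" if "b \<in> set_pmf (law_pmf M (a 1))" for b
    using law_pmf_AE[OF a1 a_bounded[OF order_refl] that] by (simp add: le_max_iff_disj)
  show "measure_pmf.expectation (law_pmf M (s 1)) (\<lambda>v. real (v $ i)) = total_service_rate M s / real CARD('n)" for i
    unfolding expectation_law_pmf[OF s1] service_rate_identical[OF identical, of i, symmetric] service_rate_def ..
  show "measure_pmf.expectation (law_pmf M (a 1)) real = real CARD('n) * (total_service_rate M s / real CARD('n)) - eps"
    unfolding expectation_law_pmf[OF a1] a_mean by simp
  show "map_pmf (\<lambda>z. pow2_step (fst z) (snd z)) (pair_pmf (law_pmf N q_bar) noise_law) = law_pmf N q_bar"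
    by (rule steady_state_stationary) (use assms in auto)
qed

lemma second_moment_net_flow:
  fixes N :: "'b measure" and q_bar :: "'b \<Rightarrow> nat ^ 'n"
  assumes "prob_space N" "q_bar \<in> N \<rightarrow>\<^sub>M count_space UNIV"
    and "converges_in_distribution (\<lambda>_. M) q N q_bar sequentially"
    and identical: "identical_servers M s"
  shows "measure_pmf.expectation noise_law (\<lambda>w. (net_flow w)\<^sup>2) = sd_a\<^sup>2 +
    (\<Sum>i\<in>UNIV. \<Sum>j\<in>UNIV. covariance M (\<lambda>\<omega>. real (s 1 \<omega> $ i)) (\<lambda>\<omega>. real (s 1 \<omega> $ j))) + eps\<^sup>2"
proof -
  interpret stationary_power_of_two with_replacement "max A_max S_max"
    "total_service_rate M s / real CARD('n)" eps "law_pmf M (s 1)" "law_pmf M (a 1)" "law_pmf N q_bar"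
    by (rule steady_state_model) (use assms in auto)
  note s1 = prob_space_axioms s_rv[OF order_refl] and a1 = prob_space_axioms a_rv[OF order_refl]
  have "(\<integral>\<omega>. real (s 1 \<omega> $ i) \<partial>M) = total_service_rate M s / real CARD('n)" for i
    using service_rate_identical[OF identical, of i] by (simp add: service_rate_def)
  moreover have "measure_pmf.variance (law_pmf M (a 1)) real = sd_a\<^sup>2"
    unfolding expectation_law_pmf[OF a1] by (rule a_variance)
  ultimately show ?thesis
    unfolding expectation_net_flow_squared by (simp add: expectation_law_pmf[OF s1] covariance_def del: One_nat_def)
qed

end

section \<open>Characteristic functions in heavy traffic\<close>

text \<open>
  The integrand on the half-line has the primitive \<open>l / c * e^(c x)\<close> with \<open>c = i t - l\<close>, which
  vanishes at infinity.
\<close>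

lemma fourier_exponential_density:
  fixes t l :: real
  assumes l: "l > 0"
  shows "(\<integral>x. (exponential_density l x) *\<^sub>R iexp (t * x) \<partial>lborel) = 1 / (1 - \<i> * t / l)"
proof -
  define c where "c = \<i> * t - complex_of_real l"
  define g where "g x = complex_of_real l * exp (c * of_real x)" for x :: real
  define G where "G x = complex_of_real l / c * exp (c * of_real x)" for x :: real
  have c: "c \<noteq> 0" using l by (auto simp: c_def complex_eq_iff)
  have norm_exp: "norm (exp (c * of_real x)) = exp (- l * x)" for x :: real
    by (simp add: c_def)
  have density: "exponential_density l x *\<^sub>R iexp (t * x) = indicator {0..} x *\<^sub>R g x" for x
    by (auto simp: exponential_density_def g_def c_def indicator_def scaleR_conv_of_real exp_diff exp_minus
        field_simps exp_of_real[symmetric] simp flip: exp_of_real)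
  have int: "integrable lborel (\<lambda>x. exponential_density l x)"
    using prob_space_exponential_density[OF l]
    by (intro integrableI_nn_integral_finite[where x = 1])
       (auto simp: exponential_density_nonneg[OF l] prob_space.emeasure_space_1[of "density lborel (exponential_density l)"]
         dest!: prob_space.emeasure_space_1 simp: emeasure_density)
  have lim: "(\<lambda>k. \<integral>x. indicator {0..real k} x *\<^sub>R g x \<partial>lborel) \<longlonglongrightarrow> (\<integral>x. indicator {0..} x *\<^sub>R g x \<partial>lborel)"
  proof (rule integral_dominated_convergence[where w = "exponential_density l"])
    show "AE x in lborel. (\<lambda>k. indicator {0..real k} x *\<^sub>R g x) \<longlonglongrightarrow> indicator {0..} x *\<^sub>R g x"
    proof (intro AE_I2 tendsto_eventually)
      fix x :: real
      show "\<forall>\<^sub>F k in sequentially. indicator {0..real k} x *\<^sub>R g x = indicator {0..} x *\<^sub>R g x"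
        using eventually_ge_at_top[of "nat \<lceil>x\<rceil>"]
        by eventually_elim (auto simp: indicator_def nat_le_iff ceiling_le_iff)
    qed
    show "AE x in lborel. norm (indicator {0..real k} x *\<^sub>R g x) \<le> exponential_density l x" for k
      using l norm_exp by (intro AE_I2) (auto simp: g_def norm_mult exponential_density_def indicator_def mult.commute)
  qed (auto simp: g_def int)
  have FTC: "(\<integral>x. indicator {0..real k} x *\<^sub>R g x \<partial>lborel) = G (real k) - G 0" for k
  proof (rule integral_FTC_atLeastAtMost)
    fix x :: real
    show "(G has_vector_derivative g x) (at x within {0..real k})"
      unfolding G_def g_def using c
      by (auto intro!: derivative_eq_intros has_vector_derivative_real_field)
    show "continuous_on {0..real k} g"
      unfolding g_def by (intro continuous_intros)
  qed simp
  have "(\<lambda>k. G (real k)) \<longlonglongrightarrow> 0"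
  proof (rule tendsto_norm_zero_cancel)
    have "norm (G x) = norm (complex_of_real l / c) * exp (- l * x)" for x
      unfolding G_def norm_mult norm_exp ..
    moreover have "(\<lambda>k. norm (complex_of_real l / c) * exp (- l * real k)) \<longlonglongrightarrow>
        norm (complex_of_real l / c) * 0"
      using l by (intro tendsto_mult tendsto_const filterlim_compose[OF exp_at_bot]
        filterlim_tendsto_neg_mult_at_bot[OF tendsto_const] filterlim_real_sequentially) auto
    ultimately show "(\<lambda>k. norm (G (real k))) \<longlonglongrightarrow> 0" by simp
  qed
  then have "(\<lambda>k. G (real k) - G 0) \<longlonglongrightarrow> 0 - G 0"
    by (intro tendsto_diff tendsto_const)
  with lim have "(\<integral>x. indicator {0..} x *\<^sub>R g x \<partial>lborel) = - G 0"
    unfolding FTC by (simp add: LIMSEQ_unique)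
  also have "- G 0 = 1 / (1 - \<i> * t / l)"
    using c l by (simp add: G_def c_def field_simps)
  finally show ?thesis unfolding density .
qed

lemma char_exponential_with_mean:
  assumes "prob_space P" and X: "exponential_with_mean P X m" and m: "m \<ge> 0"
  shows "char (distr P borel X) t = 1 / (1 - \<i> * t * m)"
proof -
  interpret prob_space P by fact
  have [measurable]: "X \<in> borel_measurable P" using X by (simp add: exponential_with_mean_def)
  have char: "char (distr P borel X) t = (\<integral>\<omega>. iexp (t * X \<omega>) \<partial>P)"
    by (simp add: char_def integral_distr)
  show ?thesis
  proof (cases "m = 0")
    case True
    then have "AE \<omega> in P. iexp (t * X \<omega>) = 1"
      using X by (auto simp: exponential_with_mean_def)
    then have "(\<integral>\<omega>. iexp (t * X \<omega>) \<partial>P) = (\<integral>\<omega>. 1 \<partial>P)"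
      by (intro integral_cong_AE) auto
    then show ?thesis by (simp add: char True prob_space)
  next
    case False
    with m have l: "1 / m > 0" by simp
    have D: "distributed P lborel X (exponential_density (1 / m))"
      using X False by (simp add: exponential_with_mean_def)
    have "(\<integral>\<omega>. iexp (t * X \<omega>) \<partial>P) = (\<integral>x. iexp (t * x) \<partial>distr P lborel X)"
      by (subst integral_distr) auto
    also have "\<dots> = (\<integral>x. (exponential_density (1 / m) x) *\<^sub>R iexp (t * x) \<partial>lborel)"
      unfolding distributed_distr_eq_density[OF D]
      by (subst integral_density) (auto simp: exponential_density_nonneg[OF l])
    also have "\<dots> = 1 / (1 - \<i> * t / complex_of_real (1 / m))"
      by (rule fourier_exponential_density[OF l])
    finally show ?thesis
      using False by (simp add: char)
  qed
qed

text \<open>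
  After division by \<open>\<epsilon>\<^sup>2\<close>, \<open>G\<close> is the net-flow factor on the left of the transform identity and \<open>H\<close> the
  common value of its two sides.  The limit \<open>L\<close> of \<open>G\<close> has imaginary part \<open>- \<tau>\<close>, so the quotient \<open>H / G\<close> is safe for
  \<open>\<tau> \<noteq> 0\<close>.
\<close>

lemma heavy_traffic_total_char:
  fixes \<sigma> :: "(nat ^ 'n) pmf" and \<alpha> :: "real \<Rightarrow> nat pmf" and \<pi> :: "real \<Rightarrow> (nat ^ 'n) pmf"
  assumes model: "\<forall>\<^sub>F \<epsilon> in at_right 0. stationary_power_of_two wr B \<mu> \<epsilon> \<sigma> (\<alpha> \<epsilon>) (\<pi> \<epsilon>)"
    and \<mu>: "\<mu> > 0"
    and variance: "((\<lambda>\<epsilon>. measure_pmf.expectation (pow2_noise wr \<sigma> (\<alpha> \<epsilon>)) (\<lambda>w. (net_flow w)\<^sup>2))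
      \<longlongrightarrow> v) (at_right 0)"
  shows "((\<lambda>\<epsilon>. total_char (\<pi> \<epsilon>) (\<epsilon> * \<tau>)) \<longlongrightarrow> 1 / (1 - \<i> * \<tau> * (v / 2))) (at_right 0)"
proof (cases "\<tau> = 0")
  case True
  then show ?thesis by (simp add: total_char_def)
next
  case False
  let ?n = "real CARD('n)"
  define C where "C = ?n * B"
  define K where "K = collapse_bound ?n B (?n * \<mu> / 2)"
  define V where "V \<epsilon> = measure_pmf.expectation (pow2_noise wr \<sigma> (\<alpha> \<epsilon>)) (\<lambda>w. (net_flow w)\<^sup>2)" for \<epsilon>
  define G where "G \<epsilon> = (flow_char (pow2_noise wr \<sigma> (\<alpha> \<epsilon>)) (\<epsilon> * \<tau>) - 1) / (complex_of_real \<epsilon>)\<^sup>2" for \<epsilon>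
  define H where "H \<epsilon> = total_char (\<pi> \<epsilon>) (\<epsilon> * \<tau>) * G \<epsilon>" for \<epsilon>
  define L where "L = - (\<i> * \<tau>) - complex_of_real (\<tau>\<^sup>2 * v / 2)"
  have L: "L \<noteq> 0" using False by (auto simp: L_def complex_eq_iff)
  have n\<mu>: "?n * \<mu> / 2 > 0" using \<mu> by simp
  have pos: "\<forall>\<^sub>F \<epsilon>::real in at_right 0. 0 < \<epsilon>" by (simp add: eventually_at_right_less)
  have small: "\<forall>\<^sub>F \<epsilon> in at_right 0. \<epsilon> < ?n * \<mu> / 2"
    by (rule eventually_at_rightI[OF _ n\<mu>]) simp
  have G_lim: "(G \<longlongrightarrow> L) (at_right 0)"
  proof -
    have "\<forall>\<^sub>F \<epsilon> in at_right 0. norm (G \<epsilon> + \<i> * \<tau> + complex_of_real (\<tau>\<^sup>2 * V \<epsilon> / 2)) \<le> \<epsilon> * (\<bar>\<tau>\<bar> ^ 3 * C ^ 3 / 6)"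
      using model pos
    proof eventually_elim
      case (elim \<epsilon>)
      interpret stationary_power_of_two wr B \<mu> \<epsilon> \<sigma> "\<alpha> \<epsilon>" "\<pi> \<epsilon>" by (rule elim)
      let ?E = "flow_char \<nu> (\<epsilon> * \<tau>) - 1 + \<i> * (\<epsilon> * \<tau> * \<epsilon>) + (\<epsilon> * \<tau>)\<^sup>2 * V \<epsilon> / 2"
      have "G \<epsilon> + \<i> * \<tau> + complex_of_real (\<tau>\<^sup>2 * V \<epsilon> / 2) = ?E / (complex_of_real \<epsilon>)\<^sup>2"
        using elim by (simp add: G_def field_simps power2_eq_square)
      then have "norm (G \<epsilon> + \<i> * \<tau> + complex_of_real (\<tau>\<^sup>2 * V \<epsilon> / 2)) = norm ?E / \<epsilon>\<^sup>2"
        using elim by (simp add: norm_divide norm_power)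
      also have "\<dots> \<le> (\<bar>\<epsilon> * \<tau>\<bar> ^ 3 * C ^ 3 / 6) / \<epsilon>\<^sup>2"
        using flow_char_expansion[of "\<epsilon> * \<tau>"] unfolding V_def C_def
        by (intro divide_right_mono) auto
      also have "\<dots> = \<epsilon> * (\<bar>\<tau>\<bar> ^ 3 * C ^ 3 / 6)"
        using elim by (simp add: abs_mult power_mult_distrib power2_eq_square power3_eq_cube)
      finally show ?case .
    qed
    moreover have "((\<lambda>\<epsilon>. \<epsilon> * (\<bar>\<tau>\<bar> ^ 3 * C ^ 3 / 6)) \<longlongrightarrow> 0) (at_right (0::real))"
      by (rule tendsto_mult_left_zero) (rule tendsto_ident_at)
    ultimately have "((\<lambda>\<epsilon>. G \<epsilon> + \<i> * \<tau> + complex_of_real (\<tau>\<^sup>2 * V \<epsilon> / 2)) \<longlongrightarrow> 0) (at_right 0)"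
      by (rule Lim_null_comparison)
    moreover have "((\<lambda>\<epsilon>. \<i> * \<tau> + complex_of_real (\<tau>\<^sup>2 * V \<epsilon> / 2)) \<longlongrightarrow>
        \<i> * \<tau> + complex_of_real (\<tau>\<^sup>2 * v / 2)) (at_right 0)"
      using variance unfolding V_def by (intro tendsto_intros) auto
    ultimately have "((\<lambda>\<epsilon>. G \<epsilon> + \<i> * \<tau> + complex_of_real (\<tau>\<^sup>2 * V \<epsilon> / 2)
        - (\<i> * \<tau> + complex_of_real (\<tau>\<^sup>2 * V \<epsilon> / 2))) \<longlongrightarrow>
        0 - (\<i> * \<tau> + complex_of_real (\<tau>\<^sup>2 * v / 2))) (at_right 0)"
      by (rule tendsto_diff)
    then show ?thesis by (simp add: L_def)
  qed
  have H_lim: "(H \<longlongrightarrow> - (\<i> * \<tau>)) (at_right 0)"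
  proof -
    have "\<forall>\<^sub>F \<epsilon> in at_right 0. norm (H \<epsilon> + \<i> * \<tau>) \<le> \<tau>\<^sup>2 * (C * \<epsilon> + sqrt \<epsilon> * (K + C)) / 2"
      using model pos small
    proof eventually_elim
      case (elim \<epsilon>)
      interpret stationary_power_of_two wr B \<mu> \<epsilon> \<sigma> "\<alpha> \<epsilon>" "\<pi> \<epsilon>" by (rule elim)
      let ?E = "total_char (\<pi> \<epsilon>) (\<epsilon> * \<tau>) * (flow_char \<nu> (\<epsilon> * \<tau>) - 1) + \<i> * (\<epsilon> * \<tau> * \<epsilon>)"
      have "H \<epsilon> + \<i> * \<tau> = ?E / (complex_of_real \<epsilon>)\<^sup>2"
        using elim by (simp add: H_def G_def field_simps power2_eq_square)
      then have "norm (H \<epsilon> + \<i> * \<tau>) = norm ?E / \<epsilon>\<^sup>2"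
        using elim by (simp add: norm_divide norm_power)
      also have "\<dots> \<le> ((\<epsilon> * \<tau>)\<^sup>2 * (C * \<epsilon> + sqrt \<epsilon> * (K + C)) / 2) / \<epsilon>\<^sup>2"
        using transform_boundary_term[OF n\<mu>, of "\<epsilon> * \<tau>"] elim unfolding C_def K_def
        by (intro divide_right_mono) (auto simp: field_simps)
      also have "\<dots> = \<tau>\<^sup>2 * (C * \<epsilon> + sqrt \<epsilon> * (K + C)) / 2"
        using elim by (simp add: power_mult_distrib)
      finally show ?case .
    qed
    moreover have "((\<lambda>\<epsilon>. \<tau>\<^sup>2 * (C * \<epsilon> + sqrt \<epsilon> * (K + C)) / 2) \<longlongrightarrow> 0) (at_right (0::real))"
    proof -
      have "((\<lambda>\<epsilon>. \<tau>\<^sup>2 * (C * \<epsilon> + sqrt \<epsilon> * (K + C)) / 2) \<longlongrightarrow>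
          \<tau>\<^sup>2 * (C * 0 + sqrt 0 * (K + C)) / 2) (at_right (0::real))"
        by (intro tendsto_intros) auto
      then show ?thesis by simp
    qed
    ultimately have "((\<lambda>\<epsilon>. H \<epsilon> + \<i> * \<tau>) \<longlongrightarrow> 0) (at_right 0)"
      by (rule Lim_null_comparison)
    from tendsto_diff[OF this tendsto_const[of "\<i> * complex_of_real \<tau>"]] show ?thesis by simp
  qed
  have quotient: "((\<lambda>\<epsilon>. H \<epsilon> / G \<epsilon>) \<longlongrightarrow> - (\<i> * \<tau>) / L) (at_right 0)"
    by (rule tendsto_divide[OF H_lim G_lim L])
  have ev: "\<forall>\<^sub>F \<epsilon> in at_right 0. H \<epsilon> / G \<epsilon> = total_char (\<pi> \<epsilon>) (\<epsilon> * \<tau>)"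
    using tendsto_imp_eventually_ne[OF G_lim L] by eventually_elim (simp add: H_def)
  have eq: "- (\<i> * \<tau>) / L = 1 / (1 - \<i> * \<tau> * (v / 2))"
  proof -
    have "L = - (\<i> * \<tau>) * (1 - \<i> * \<tau> * (v / 2))"
      by (simp add: L_def algebra_simps power2_eq_square)
    then show ?thesis using False by simp
  qed
  show ?thesis using Lim_transform_eventually[OF quotient ev] unfolding eq .
qed

section \<open>From the total queue length to the queue length vector\<close>

text \<open>
  Slutsky's theorem for random vectors whose components all approach one scalar variable.  A
  continuous test function is uniformly continuous only on compact sets.  A comparison of the test
  function at \<open>X\<close> and at \<open>Y\<close> times the all-ones vector therefore fails in two rare events: \<open>Z\<close> is large,
  which has small probability by Markov's inequality, or \<open>Y\<close> is large.  The second event is controlled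
  by a continuous function \<open>h\<close> between the indicators of \<open>\<bar>y\<bar> \<ge> r + 1\<close> and \<open>\<bar>y\<bar> > r\<close>, to whose expectation
  weak convergence applies.
\<close>

lemma slutsky_diagonal:
  fixes p :: "nat \<Rightarrow> 'a pmf" and X :: "nat \<Rightarrow> 'a \<Rightarrow> real ^ 'n" and Y Z :: "nat \<Rightarrow> 'a \<Rightarrow> real"
    and P :: "'c measure" and \<Upsilon> :: "'c \<Rightarrow> real" and f :: "real ^ 'n \<Rightarrow> real"
  assumes P: "prob_space P" and \<Upsilon>[measurable]: "\<Upsilon> \<in> borel_measurable P"
    and weak: "weak_conv_m (\<lambda>k. distr (p k) borel (Y k)) (distr P borel \<Upsilon>)"
    and close: "\<And>k x i. \<bar>X k x $ i - Y k x\<bar> \<le> Z k x"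
    and Z_int: "\<And>k. integrable (p k) (Z k)"
    and Z_lim: "(\<lambda>k. measure_pmf.expectation (p k) (Z k)) \<longlonglongrightarrow> 0"
    and f: "continuous_on UNIV f" "bounded (range f)"
  shows "(\<lambda>k. measure_pmf.expectation (p k) (\<lambda>x. f (X k x))) \<longlonglongrightarrow> (\<integral>\<omega>. f (\<Upsilon> \<omega> *\<^sub>R (\<chi> i. 1)) \<partial>P)"
proof -
  interpret P: prob_space P by fact
  interpret D: real_distribution "distr P borel \<Upsilon>" by simp
  let ?one = "(\<chi> i. 1) :: real ^ 'n" and ?n = "real CARD('n)"
  obtain b where b: "\<And>x. \<bar>f x\<bar> \<le> b" "b > 0"
    using f(2) unfolding bounded_pos by auto
  have test: "(\<lambda>k. measure_pmf.expectation (p k) (\<lambda>x. h (Y k x))) \<longlonglongrightarrow> (\<integral>\<omega>. h (\<Upsilon> \<omega>) \<partial>P)"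
    if h: "continuous_on UNIV h" "\<And>y. \<bar>h y\<bar> \<le> c" for h :: "real \<Rightarrow> real" and c
  proof -
    have [measurable]: "h \<in> borel_measurable borel"
      using h(1) by (rule borel_measurable_continuous_onI)
    have "(\<lambda>k. integral\<^sup>L (distr (p k) borel (Y k)) h) \<longlonglongrightarrow> integral\<^sup>L (distr P borel \<Upsilon>) h"
      using h weak
      by (intro weak_conv_imp_integral_bdd_continuous_conv[where B = c])
         (auto simp: continuous_on_eq_continuous_at prob_space.real_distribution_distr[OF prob_space_measure_pmf])
    then show ?thesis by (simp add: integral_distr)
  qed
  define g where "g y = f (y *\<^sub>R ?one)" for y :: real
  have g: "continuous_on UNIV g"
    unfolding g_def by (intro continuous_on_compose2[OF f(1)] continuous_intros) auto
  have "(\<lambda>k. measure_pmf.expectation (p k) (\<lambda>x. f (X k x)) -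
      measure_pmf.expectation (p k) (\<lambda>x. g (Y k x))) \<longlonglongrightarrow> 0"
  proof (rule LIMSEQ_I)
    fix e :: real assume e: "e > 0"
    \<comment> \<open>the final estimate is \<open>\<delta>\<close> from uniform continuity, \<open>2 b \<delta>\<close> from large \<open>Y\<close> and \<open>\<delta>\<close> from large \<open>Z\<close>\<close>
    define \<delta> where "\<delta> = e / (2 + 2 * b)"
    have \<delta>: "\<delta> > 0" "\<delta> * (2 + 2 * b) = e" using e b(2) by (auto simp: \<delta>_def)
    define h where "h r y = min (max (\<bar>y\<bar> - r) 0) 1" for r y :: real
    have h: "0 \<le> h r y" "\<bar>h r y\<bar> \<le> 1" for r y by (auto simp: h_def)
    have h_cont: "continuous_on UNIV (h r)" for r
      unfolding h_def by (intro continuous_intros)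
    have [measurable]: "h r \<in> borel_measurable borel" for r
      using h_cont by (rule borel_measurable_continuous_onI)
    obtain r where r: "r \<ge> 0" "(\<integral>\<omega>. h r (\<Upsilon> \<omega>) \<partial>P) < \<delta>"
    proof -
      have "(\<lambda>m. \<integral>\<omega>. h (real m) (\<Upsilon> \<omega>) \<partial>P) \<longlonglongrightarrow> (\<integral>\<omega>. 0 \<partial>P)"
      proof (rule integral_dominated_convergence[where w = "\<lambda>_. 1"])
        show "AE \<omega> in P. (\<lambda>m. h (real m) (\<Upsilon> \<omega>)) \<longlonglongrightarrow> 0"
        proof (intro AE_I2 tendsto_eventually)
          fix \<omega>
          show "\<forall>\<^sub>F m in sequentially. h (real m) (\<Upsilon> \<omega>) = 0"
            using eventually_ge_at_top[of "nat \<lceil>\<bar>\<Upsilon> \<omega>\<bar>\<rceil>"]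
            by eventually_elim (auto simp: h_def nat_le_iff ceiling_le_iff)
        qed
      qed (use h in auto)
      then have "\<forall>\<^sub>F m in sequentially. (\<integral>\<omega>. h (real m) (\<Upsilon> \<omega>) \<partial>P) < \<delta>"
        using \<delta>(1) by (intro order_tendstoD(2)) auto
      then obtain m where "(\<integral>\<omega>. h (real m) (\<Upsilon> \<omega>) \<partial>P) < \<delta>"
        by (auto simp: eventually_sequentially)
      then show ?thesis using that[of "real m"] by simp
    qed
    have "uniformly_continuous_on (cball 0 (?n * (r + 2))) f"
      using f(1) by (intro compact_uniformly_continuous) (auto intro: continuous_on_subset)
    then obtain \<eta> where \<eta>: "\<eta> > 0"
      "\<And>x y. x \<in> cball 0 (?n * (r + 2)) \<Longrightarrow> y \<in> cball 0 (?n * (r + 2)) \<Longrightarrow> dist x y < \<eta> \<Longrightarrow> \<bar>f x - f y\<bar> < \<delta>"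
      using \<delta>(1) unfolding uniformly_continuous_on_def dist_real_def by (metis dist_commute)
    \<comment> \<open>if \<open>Z < \<theta>\<close> and \<open>\<bar>Y\<bar> < r + 1\<close>, then both points are in the ball on which \<open>\<eta>\<close> was chosen and are closer than \<open>\<eta>\<close>\<close>
    define \<theta> where "\<theta> = min 1 (\<eta> / ?n)"
    have \<theta>: "\<theta> > 0" "\<theta> \<le> 1" "?n * \<theta> \<le> \<eta>" using \<eta>(1) by (auto simp: \<theta>_def min_def field_simps)
    have norm_le: "norm v \<le> ?n * c" if "\<And>i. \<bar>v $ i\<bar> \<le> c" for v :: "real ^ 'n" and c
    proof -
      have "norm v \<le> (\<Sum>i\<in>UNIV. \<bar>v $ i\<bar>)" by (rule norm_le_l1_cart)
      also have "\<dots> \<le> (\<Sum>i::'n\<in>UNIV. c)" by (intro sum_mono that)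
      finally show ?thesis by simp
    qed
    have pointwise: "\<bar>f (X k x) - g (Y k x)\<bar> \<le> \<delta> + 2 * b * h r (Y k x) + 2 * b / \<theta> * Z k x" for k x
    proof -
      have Z: "0 \<le> Z k x" using close[of k x undefined] by linarith
      have crude: "\<bar>f (X k x) - g (Y k x)\<bar> \<le> 2 * b"
        using b(1)[of "X k x"] b(1)[of "Y k x *\<^sub>R ?one"] unfolding g_def by linarith
      have nonneg: "0 \<le> 2 * b * h r (Y k x)" "0 \<le> 2 * b / \<theta> * Z k x"
        using h(1) b(2) \<theta>(1) Z by auto
      consider "Z k x \<ge> \<theta>" | "\<bar>Y k x\<bar> \<ge> r + 1" | "Z k x < \<theta>" "\<bar>Y k x\<bar> < r + 1" by linarith
      then show ?thesis
      proof cases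
        case 1
        then have "2 * b \<le> 2 * b / \<theta> * Z k x" using \<theta>(1) b(2) by (simp add: field_simps)
        then show ?thesis using crude nonneg \<delta>(1) by linarith
      next
        case 2
        then have "h r (Y k x) = 1" by (simp add: h_def)
        then show ?thesis using crude nonneg \<delta>(1) by simp
      next
        case 3
        have "norm (X k x) \<le> ?n * (r + 2)"
        proof (rule norm_le)
          show "\<bar>X k x $ i\<bar> \<le> r + 2" for i using close[of k x i] 3 \<theta>(2) by linarith
        qed
        moreover have "norm (Y k x *\<^sub>R ?one) \<le> ?n * (r + 2)"
          using 3 by (intro norm_le) simp
        moreover have "norm (X k x - Y k x *\<^sub>R ?one) \<le> ?n * Z k x"
          using close by (intro norm_le) simp
        moreover have "?n * Z k x < \<eta>"
        proof -
          have "?n * Z k x < ?n * \<theta>" using 3 by (intro mult_strict_left_mono) auto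
          with \<theta>(3) show ?thesis by linarith
        qed
        ultimately have "\<bar>f (X k x) - g (Y k x)\<bar> < \<delta>"
          unfolding g_def by (intro \<eta>(2)) (auto simp: dist_norm)
        then show ?thesis using nonneg by linarith
      qed
    qed
    have "\<forall>\<^sub>F k in sequentially. measure_pmf.expectation (p k) (\<lambda>x. h r (Y k x)) < \<delta>"
      using order_tendstoD(2)[OF test[OF h_cont h(2)] r(2)] .
    moreover have "\<forall>\<^sub>F k in sequentially. measure_pmf.expectation (p k) (Z k) < \<delta> * \<theta> / (2 * b)"
      using \<delta>(1) \<theta>(1) b(2) by (intro order_tendstoD(2)[OF Z_lim]) auto
    ultimately have "\<forall>\<^sub>F k in sequentially. norm (measure_pmf.expectation (p k) (\<lambda>x. f (X k x)) -
      measure_pmf.expectation (p k) (\<lambda>x. g (Y k x)) - 0) < e"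
    proof eventually_elim
      case (elim k)
      have ints: "integrable (p k) (\<lambda>x. f (X k x))" "integrable (p k) (\<lambda>x. g (Y k x))"
        by (rule integrable_pmf_bounded[where B = b], use b(1) in \<open>simp add: g_def\<close>)+
      have h_int: "integrable (p k) (\<lambda>x. h r (Y k x))"
        by (rule integrable_pmf_bounded[where B = 1]) (use h(2) in simp)
      have "norm (measure_pmf.expectation (p k) (\<lambda>x. f (X k x)) - measure_pmf.expectation (p k) (\<lambda>x. g (Y k x)))
          = norm (measure_pmf.expectation (p k) (\<lambda>x. f (X k x) - g (Y k x)))"
        using ints by simp
      also have "\<dots> \<le> measure_pmf.expectation (p k) (\<lambda>x. \<delta> + 2 * b * h r (Y k x) + 2 * b / \<theta> * Z k x)"
        using ints h_int Z_int[of k] pointwise by (intro norm_expectation_pmf_le) auto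
      also have "\<dots> = \<delta> + 2 * b * measure_pmf.expectation (p k) (\<lambda>x. h r (Y k x))
          + 2 * b / \<theta> * measure_pmf.expectation (p k) (Z k)"
        using ints h_int Z_int[of k] by simp
      also have "\<dots> < \<delta> + 2 * b * \<delta> + 2 * b / \<theta> * (\<delta> * \<theta> / (2 * b))"
        using elim b(2) \<theta>(1) by (intro add_strict_mono add_strict_left_mono mult_strict_left_mono) auto
      also have "\<dots> = e"
        using \<delta>(2) \<theta>(1) b(2) by (simp add: field_simps)
      finally show ?case by simp
    qed
    then show "\<exists>k0. \<forall>k\<ge>k0. norm (measure_pmf.expectation (p k) (\<lambda>x. f (X k x)) -
      measure_pmf.expectation (p k) (\<lambda>x. g (Y k x)) - 0) < e"
      by (simp add: eventually_sequentially)
  qed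
  moreover have "(\<lambda>k. measure_pmf.expectation (p k) (\<lambda>x. g (Y k x))) \<longlonglongrightarrow> (\<integral>\<omega>. g (\<Upsilon> \<omega>) \<partial>P)"
    by (rule test[OF g, of b]) (simp add: g_def b)
  ultimately have "(\<lambda>k. measure_pmf.expectation (p k) (\<lambda>x. f (X k x)) -
      measure_pmf.expectation (p k) (\<lambda>x. g (Y k x)) + measure_pmf.expectation (p k) (\<lambda>x. g (Y k x)))
      \<longlonglongrightarrow> 0 + (\<integral>\<omega>. g (\<Upsilon> \<omega>) \<partial>P)"
    by (rule tendsto_add)
  then show ?thesis by (simp add: g_def)
qed

lemma component_near_mean:
  fixes x :: "nat ^ 'n"
  shows "\<bar>real_vec x $ i - total_queue x / real CARD('n)\<bar> \<le> spread (real_vec x)"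
proof -
  let ?n = "real CARD('n)"
  have "real_vec x $ i - total_queue x / ?n = (\<Sum>j\<in>UNIV. real_vec x $ i - real_vec x $ j) / ?n"
    by (simp add: sum_subtractf total_queue_def real_vec_def diff_divide_distrib)
  then have "\<bar>real_vec x $ i - total_queue x / ?n\<bar> = \<bar>\<Sum>j\<in>UNIV. real_vec x $ i - real_vec x $ j\<bar> / ?n"
    by simp
  also have "\<dots> \<le> \<bar>\<Sum>j\<in>UNIV. real_vec x $ i - real_vec x $ j\<bar>"
    by (simp add: divide_le_eq mult_le_cancel_left1)
  also have "\<dots> \<le> (\<Sum>j\<in>UNIV. \<bar>real_vec x $ i - real_vec x $ j\<bar>)"
    by (rule sum_abs)
  also have "\<dots> \<le> spread (real_vec x)"
    unfolding spread_def by (rule member_le_sum) (auto intro: sum_nonneg)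
  finally show ?thesis .
qed

theorem corollary2:
  fixes M :: "'a measure"
    and with_replacement :: bool
    and A_max S_max :: real
    and s :: "nat \<Rightarrow> 'a \<Rightarrow> nat ^ 'n"
    and a :: "real \<Rightarrow> nat \<Rightarrow> 'a \<Rightarrow> nat"
    and cand :: "real \<Rightarrow> nat \<Rightarrow> 'a \<Rightarrow> 'n \<times> 'n"
    and coin :: "real \<Rightarrow> nat \<Rightarrow> 'a \<Rightarrow> bool"
    and q :: "real \<Rightarrow> nat \<Rightarrow> 'a \<Rightarrow> nat ^ 'n"
    and sd_a :: "real \<Rightarrow> real"
    and sd_a_lim :: real
    and N :: "real \<Rightarrow> 'b measure"
    and q_bar :: "real \<Rightarrow> 'b \<Rightarrow> nat ^ 'n"
    and P :: "'c measure"
    and \<Upsilon> :: "'c \<Rightarrow> real"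
  assumes rate_pos: "total_service_rate M s > 0"
    and system:
      "\<And>\<epsilon>. \<epsilon> \<in> {0<..<total_service_rate M s} \<Longrightarrow>
         power_of_two_system M with_replacement A_max S_max s
           \<epsilon> (sd_a \<epsilon>) (a \<epsilon>) (cand \<epsilon>) (coin \<epsilon>) (q \<epsilon>)"
    and identical: "identical_servers M s"
    and sd_a_limit: "(sd_a \<longlongrightarrow> sd_a_lim) (at_right 0)"
    and steady_state_space:
      "\<And>\<epsilon>. \<epsilon> \<in> {0<..<total_service_rate M s} \<Longrightarrow> prob_space (N \<epsilon>)"
    and steady_state_rv:
      "\<And>\<epsilon>. \<epsilon> \<in> {0<..<total_service_rate M s} \<Longrightarrow> q_bar \<epsilon> \<in> N \<epsilon> \<rightarrow>\<^sub>M count_space UNIV"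
    and steady_state:
      "\<And>\<epsilon>. \<epsilon> \<in> {0<..<total_service_rate M s} \<Longrightarrow>
         converges_in_distribution (\<lambda>_. M) (q \<epsilon>) (N \<epsilon>) (q_bar \<epsilon>) sequentially"
    and limit_space: "prob_space P"
    and limit_rv:
      "exponential_with_mean P \<Upsilon>
         (1 / (2 * real CARD('n)) *
           (sd_a_lim\<^sup>2 +
            (\<Sum>i\<in>UNIV. \<Sum>j\<in>UNIV.
               covariance M (\<lambda>\<omega>. real (s 1 \<omega> $ i)) (\<lambda>\<omega>. real (s 1 \<omega> $ j)))))"
  shows "converges_in_distribution N (\<lambda>\<epsilon> \<omega>. \<epsilon> *\<^sub>R real_vec (q_bar \<epsilon> \<omega>))
           P (\<lambda>\<omega>. \<Upsilon> \<omega> *\<^sub>R (\<chi> i. 1)) (at_right 0)"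
proof -
  let ?n = "real CARD('n)" and ?rate = "total_service_rate M s"
  define v where "v = sd_a_lim\<^sup>2 +
    (\<Sum>i\<in>UNIV. \<Sum>j\<in>UNIV. covariance M (\<lambda>\<omega>. real (s 1 \<omega> $ i)) (\<lambda>\<omega>. real (s 1 \<omega> $ j)))"
  define \<sigma> where "\<sigma> = law_pmf M (s 1)"
  define \<alpha> where "\<alpha> \<epsilon> = law_pmf M (a \<epsilon> 1)" for \<epsilon>
  define \<pi> where "\<pi> \<epsilon> = law_pmf (N \<epsilon>) (q_bar \<epsilon>)" for \<epsilon>
  define B where "B = max A_max S_max"
  have model: "stationary_power_of_two with_replacement B (?rate / ?n) \<epsilon> \<sigma> (\<alpha> \<epsilon>) (\<pi> \<epsilon>)"
    and flow: "measure_pmf.expectation (pow2_noise with_replacement \<sigma> (\<alpha> \<epsilon>)) (\<lambda>w. (net_flow w)\<^sup>2) =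
      v - sd_a_lim\<^sup>2 + (sd_a \<epsilon>)\<^sup>2 + \<epsilon>\<^sup>2"
    if \<epsilon>: "\<epsilon> \<in> {0<..<?rate}" for \<epsilon>
  proof -
    interpret power_of_two_system M with_replacement A_max S_max s \<epsilon> "sd_a \<epsilon>" "a \<epsilon>" "cand \<epsilon>" "coin \<epsilon>" "q \<epsilon>"
      by (rule system[OF \<epsilon>])
    note steady = steady_state_space[OF \<epsilon>] steady_state_rv[OF \<epsilon>] steady_state[OF \<epsilon>] identical
    show "stationary_power_of_two with_replacement B (?rate / ?n) \<epsilon> \<sigma> (\<alpha> \<epsilon>) (\<pi> \<epsilon>)"
      unfolding B_def \<sigma>_def \<alpha>_def \<pi>_def by (rule steady_state_model[OF steady])
    show "measure_pmf.expectation (pow2_noise with_replacement \<sigma> (\<alpha> \<epsilon>)) (\<lambda>w. (net_flow w)\<^sup>2) =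
        v - sd_a_lim\<^sup>2 + (sd_a \<epsilon>)\<^sup>2 + \<epsilon>\<^sup>2"
      unfolding \<sigma>_def \<alpha>_def second_moment_net_flow[OF steady] v_def by simp
  qed
  have near_0: "\<forall>\<^sub>F \<epsilon> in at_right 0. \<epsilon> \<in> {0<..<?rate}"
    by (rule eventually_at_rightI[OF _ rate_pos]) simp
  \<comment> \<open>\<open>v\<close> is the limit of second moments of the net flow; its sign is needed to read the limit law as
    exponential\<close>
  have v_nonneg: "0 \<le> v"
  proof -
    have "((\<lambda>\<epsilon>. v - sd_a_lim\<^sup>2 + (sd_a \<epsilon>)\<^sup>2 + \<epsilon>\<^sup>2) \<longlongrightarrow> v - sd_a_lim\<^sup>2 + sd_a_lim\<^sup>2 + 0\<^sup>2) (at_right 0)"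
      by (intro tendsto_intros sd_a_limit)
    moreover have "\<forall>\<^sub>F \<epsilon> in at_right 0. 0 \<le> v - sd_a_lim\<^sup>2 + (sd_a \<epsilon>)\<^sup>2 + \<epsilon>\<^sup>2"
      using near_0 by eventually_elim (simp flip: flow)
    ultimately have "0 \<le> v - sd_a_lim\<^sup>2 + sd_a_lim\<^sup>2 + 0\<^sup>2"
      by (intro tendsto_lowerbound) auto
    then show ?thesis by simp
  qed
  have total_lim: "((\<lambda>\<epsilon>. total_char (\<pi> \<epsilon>) (\<epsilon> * \<tau>)) \<longlongrightarrow> 1 / (1 - \<i> * \<tau> * (v / 2))) (at_right 0)" for \<tau>
  proof (rule heavy_traffic_total_char)
    show "\<forall>\<^sub>F \<epsilon> in at_right 0. stationary_power_of_two with_replacement B (?rate / ?n) \<epsilon> \<sigma> (\<alpha> \<epsilon>) (\<pi> \<epsilon>)"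
      using near_0 by eventually_elim (rule model)
    show "?rate / ?n > 0" using rate_pos by simp
    have "((\<lambda>\<epsilon>. v - sd_a_lim\<^sup>2 + (sd_a \<epsilon>)\<^sup>2 + \<epsilon>\<^sup>2) \<longlongrightarrow> v - sd_a_lim\<^sup>2 + sd_a_lim\<^sup>2 + 0\<^sup>2) (at_right 0)"
      by (intro tendsto_intros sd_a_limit)
    moreover have "\<forall>\<^sub>F \<epsilon> in at_right 0. v - sd_a_lim\<^sup>2 + (sd_a \<epsilon>)\<^sup>2 + \<epsilon>\<^sup>2 =
        measure_pmf.expectation (pow2_noise with_replacement \<sigma> (\<alpha> \<epsilon>)) (\<lambda>w. (net_flow w)\<^sup>2)"
      using near_0 by eventually_elim (simp add: flow)
    ultimately show "((\<lambda>\<epsilon>. measure_pmf.expectation (pow2_noise with_replacement \<sigma> (\<alpha> \<epsilon>)) (\<lambda>w. (net_flow w)\<^sup>2))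
        \<longlongrightarrow> v) (at_right 0)"
      by (auto dest: Lim_transform_eventually)
  qed
  have exponential: "exponential_with_mean P \<Upsilon> (1 / (2 * ?n) * v)"
    using limit_rv by (simp add: v_def)
  have \<Upsilon>_rv: "\<Upsilon> \<in> borel_measurable P"
    using exponential by (simp add: exponential_with_mean_def)
  show ?thesis
    unfolding converges_in_distribution_def
  proof (intro allI impI)
    fix f :: "real ^ 'n \<Rightarrow> real"
    assume f: "continuous_on UNIV f" "bounded (range f)"
    show "((\<lambda>\<epsilon>. \<integral>\<omega>. f (\<epsilon> *\<^sub>R real_vec (q_bar \<epsilon> \<omega>)) \<partial>N \<epsilon>) \<longlongrightarrow> (\<integral>\<omega>. f (\<Upsilon> \<omega> *\<^sub>R (\<chi> i. 1)) \<partial>P)) (at_right 0)"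
    proof (rule tendsto_at_right_sequentially)
      \<comment> \<open>half of the capacity keeps the arrival rate at least \<open>?rate / 2\<close>, so that the collapse bound
        is uniform\<close>
      show "0 < ?rate / 2" using rate_pos by simp
      fix S :: "nat \<Rightarrow> real"
      assume S: "\<And>k. 0 < S k" "\<And>k. S k < ?rate / 2" "S \<longlonglongrightarrow> 0"
      have in_range: "S k \<in> {0<..<?rate}" for k
        using S(1)[of k] S(2)[of k] rate_pos by simp
      have S_at_right: "filterlim S (at_right 0) sequentially"
        using S(1) by (intro tendsto_imp_filterlim_at_right S(3)) simp
      let ?p = "\<lambda>k. \<pi> (S k)"
      let ?Y = "\<lambda>k x. S k * total_queue x / ?n"
      let ?Z = "\<lambda>k x. S k * spread (real_vec x)"
      define K where "K = collapse_bound ?n B (?rate / 2)"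
      have spread_le: "spread (real_vec x) \<le> 1 + (spread (real_vec x))\<^sup>2" for x :: "nat ^ 'n"
        using zero_le_power2[of "spread (real_vec x) - 1"] spread_nonneg[of "real_vec x"]
        by (simp add: power2_eq_square algebra_simps)
      have collapse: "integrable (?p k) (\<lambda>x. (spread (real_vec x))\<^sup>2)"
        "measure_pmf.expectation (?p k) (\<lambda>x. (spread (real_vec x))\<^sup>2) \<le> K" for k
      proof -
        interpret stationary_power_of_two with_replacement B "?rate / ?n" "S k" \<sigma> "\<alpha> (S k)" "\<pi> (S k)"
          by (rule model[OF in_range])
        have "?rate / 2 \<le> ?n * (?rate / ?n) - S k" using S(2)[of k] by simp
        from state_space_collapse[OF _ this] rate_pos
        show "integrable (?p k) (\<lambda>x. (spread (real_vec x))\<^sup>2)"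
          "measure_pmf.expectation (?p k) (\<lambda>x. (spread (real_vec x))\<^sup>2) \<le> K"
          by (simp_all add: K_def)
      qed
      have spread_int: "integrable (?p k) (\<lambda>x. spread (real_vec x))" for k
      proof (rule Bochner_Integration.integrable_bound)
        show "integrable (?p k) (\<lambda>x. 1 + (spread (real_vec x))\<^sup>2)"
          using collapse(1) by simp
        show "AE x in ?p k. norm (spread (real_vec x)) \<le> norm (1 + (spread (real_vec x))\<^sup>2)"
          using spread_le by (intro AE_I2) (simp add: spread_nonneg)
      qed simp
      have "(\<lambda>k. measure_pmf.expectation (?p k) (\<lambda>x. f (S k *\<^sub>R real_vec x)))
          \<longlonglongrightarrow> (\<integral>\<omega>. f (\<Upsilon> \<omega> *\<^sub>R (\<chi> i. 1)) \<partial>P)"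
      proof (rule slutsky_diagonal[where Y = ?Y and Z = ?Z, OF limit_space \<Upsilon>_rv _ _ _ _ f])
        show "weak_conv_m (\<lambda>k. distr (?p k) borel (?Y k)) (distr P borel \<Upsilon>)"
        proof (rule levy_continuity)
          show "real_distribution (distr (?p k) borel (?Y k))" for k
            by (rule prob_space.real_distribution_distr[OF prob_space_measure_pmf]) simp
          show "real_distribution (distr P borel \<Upsilon>)"
            by (rule prob_space.real_distribution_distr[OF limit_space \<Upsilon>_rv])
          fix t
          have "char (distr (?p k) borel (?Y k)) t = total_char (?p k) (S k * (t / ?n))" for k
            by (simp add: char_def integral_distr total_char_def mult_ac)
          moreover have "(\<lambda>k. total_char (?p k) (S k * (t / ?n))) \<longlonglongrightarrow> 1 / (1 - \<i> * (t / ?n) * (v / 2))"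
            by (rule filterlim_compose[OF total_lim S_at_right])
          moreover have "char (distr P borel \<Upsilon>) t = 1 / (1 - \<i> * (t / ?n) * (v / 2))"
            unfolding char_exponential_with_mean[OF limit_space exponential mult_nonneg_nonneg[OF _ v_nonneg], simplified]
            by (simp add: mult_ac)
          ultimately show "(\<lambda>k. char (distr (?p k) borel (?Y k)) t) \<longlonglongrightarrow> char (distr P borel \<Upsilon>) t"
            by simp
        qed
        show "\<bar>(S k *\<^sub>R real_vec x) $ i - ?Y k x\<bar> \<le> ?Z k x" for k i and x :: "nat ^ 'n"
        proof -
          have "(S k *\<^sub>R real_vec x) $ i - ?Y k x = S k * (real_vec x $ i - total_queue x / ?n)"
            by (simp add: right_diff_distrib)
          then show ?thesis
            using component_near_mean[of x i] S(1)[of k] by (simp add: abs_mult mult_left_mono)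
        qed
        show "integrable (?p k) (?Z k)" for k
          using spread_int by simp
        show "(\<lambda>k. measure_pmf.expectation (?p k) (?Z k)) \<longlonglongrightarrow> 0"
        proof (rule tendsto_sandwich[OF _ _ tendsto_const])
          show "\<forall>\<^sub>F k in sequentially. 0 \<le> measure_pmf.expectation (?p k) (?Z k)"
            using S(1) by (auto intro!: always_eventually integral_nonneg simp: spread_nonneg less_imp_le)
          have "measure_pmf.expectation (?p k) (?Z k) \<le> S k * (1 + K)" for k
          proof -
            have "measure_pmf.expectation (?p k) (\<lambda>x. spread (real_vec x)) \<le>
                measure_pmf.expectation (?p k) (\<lambda>x. 1 + (spread (real_vec x))\<^sup>2)"
              using spread_int collapse(1) spread_le by (intro integral_mono) auto
            also have "\<dots> \<le> 1 + K" using collapse[of k] by simp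
            finally show ?thesis using S(1)[of k] by (simp add: mult_left_mono)
          qed
          then show "\<forall>\<^sub>F k in sequentially. measure_pmf.expectation (?p k) (?Z k) \<le> S k * (1 + K)"
            by simp
          show "(\<lambda>k. S k * (1 + K)) \<longlonglongrightarrow> 0"
            using S(3) by (rule tendsto_mult_left_zero)
        qed
      qed
      then show "(\<lambda>k. \<integral>\<omega>. f (S k *\<^sub>R real_vec (q_bar (S k) \<omega>)) \<partial>N (S k))
          \<longlonglongrightarrow> (\<integral>\<omega>. f (\<Upsilon> \<omega> *\<^sub>R (\<chi> i. 1)) \<partial>P)"
        unfolding \<pi>_def
        by (subst (asm) expectation_law_pmf[OF steady_state_space[OF in_range] steady_state_rv[OF in_range]])
    qed
  qed
qed

end
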